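(* Let $0<\alpha<1$, $T>0$, $\phi_0\in\mathbb{R}$, $\lambda\ge 0$, $1\le k\le 5$, and let $\tau_k$, $G=(g_{ij})$ be as in the context. The semi-discrete BDF-$k$ scheme $$\frac{1-\theta}{\Delta t}\mathcal{L}\varphi^{n+1}(\theta)+\theta\varphi^{n+1}(\theta)=-\lambda\,\mathcal{C}[\varphi^{n+1}]+\theta\phi_0,\qquad \theta\in(0,1),\ n=k-1,\dots,N,$$ is stable in the sense that $$\lambda_{min}\|\varphi^{N+1}\|^2_{L^2_{\omega_{\alpha,0}}}+\frac{\Delta t}{2}(1-\tau_k^2)\sum_{n=k-1}^{N}\left(\|\varphi^{n+1}\|^2_{L^2_{\omega_{\alpha,1}}}+\lambda|\phi^{n+1}|^2\right)\le\frac{1}{1-\tau_k^2}\left[\lambda_{max}\alpha+\frac{T}{2}(1-\alpha)\right]|\phi_0|^2,$$ where $\lambda_{min}$ and $\lambda_{max}$ are the minimum and the maximum eigenvalue of the positive definite symmetric matrix $G$, and $\phi^n=\mathcal{C}[\varphi^n]$.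
   Context: Weights on $(0,1)$: $\omega_\alpha(\theta)=\frac{\theta^{-\alpha}(1-\theta)^{\alpha-1}}{\Gamma(1-\alpha)\Gamma(\alpha)}$, $\omega_{\alpha,0}(\theta)=(1-\theta)\omega_\alpha(\theta)$, $\omega_{\alpha,1}(\theta)=\theta\omega_\alpha(\theta)$; $\|v\|^2_{L^2_\omega}=\int_0^1 v^2\omega\,d\theta$; $\mathcal{C}[v]=\int_0^1 v(\theta)\omega_\alpha(\theta)\,d\theta$. Time grid: $t_n=n\Delta t$, with $\Delta t=T/(N+1)$, so $t_{N+1}=T$. The scheme discretizes in time the equation $\partial_t\varphi+\frac{\theta}{1-\theta}\varphi=-\frac{\lambda}{1-\theta}\mathcal{C}[\varphi]+\frac{\theta}{1-\theta}\phi_0$, $\varphi(0,\theta)=\phi_0$ (multiplied by $1-\theta$); $\varphi^n(\theta)$ approximates $\varphi(t_n,\theta)$. BDF operator: $\mathcal{L}\varphi^{n+1}=\alpha_k\varphi^{n+1}-\sum_{j=0}^{k-1}b_j^{(k)}\varphi^{n-j}$, with coefficients $k=1$: $\alpha_1=1$, $b=(1)$; $k=2$: $\alpha_2=\frac32$, $b=(2,-\frac12)$; $k=3$: $\alpha_3=\frac{11}{6}$, $b=(3,-\frac32,\frac13)$; $k=4$: $\alpha_4=\frac{25}{12}$, $b=(4,-3,\frac43,-\frac14)$; $k=5$: $\alpha_5=\frac{137}{60}$, $b=(5,-5,\frac{10}{3},-\frac54,\frac15)$. Starting values: $\varphi^0=\phi_0$, and for $k\ge2$ the values $\varphi^1,\dots,\varphi^{k-1}$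 are computed with the lower-order schemes ($\varphi^j$ by the BDF-$j$ scheme). The constants $\tau_k$ and $G$: $\tau_1=\tau_2=0$, $\tau_3=0.0836$, $\tau_4=0.2878$, $\tau_5=0.8160$, and $G=(g_{ij})\in\mathbb{R}^{k,k}$ is a symmetric positive definite matrix for which there exist real numbers $\delta_0,\dots,\delta_k$ with (known result on BDF multipliers) $$(\mathcal{L}\varphi^{n+1},\varphi^{n+1}-\tau_k\varphi^n)=\sum_{i,j=1}^k g_{ij}(\varphi^{n+1+i-k},\varphi^{n+1+j-k})-\sum_{i,j=1}^k g_{ij}(\varphi^{n+i-k},\varphi^{n+j-k})+\Big\|\sum_{i=0}^k\delta_i\varphi^{n+1+i-k}\Big\|^2$$ for all sequences in a real inner product space. *)

theory Defs
  imports "HOL-Analysis.Analysis" "Jordan_Normal_Form.Spectral_Radius"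
begin

definition omega :: "real \<Rightarrow> real \<Rightarrow> real" where
  "omega \<alpha> \<theta> = \<theta> powr (- \<alpha>) * (1 - \<theta>) powr (\<alpha> - 1) / (Gamma (1 - \<alpha>) * Gamma \<alpha>)"

definition omega0 :: "real \<Rightarrow> real \<Rightarrow> real" where
  "omega0 \<alpha> \<theta> = (1 - \<theta>) * omega \<alpha> \<theta>"

definition omega1 :: "real \<Rightarrow> real \<Rightarrow> real" where
  "omega1 \<alpha> \<theta> = \<theta> * omega \<alpha> \<theta>"

definition weighted_norm_sq :: "(real \<Rightarrow> real) \<Rightarrow> (real \<Rightarrow> real) \<Rightarrow> real" where
  "weighted_norm_sq w v = set_lebesgue_integral lborel {0<..<1} (\<lambda>\<theta>. (v \<theta>)\<^sup>2 * w \<theta>)"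

definition C_op :: "real \<Rightarrow> (real \<Rightarrow> real) \<Rightarrow> real" where
  "C_op \<alpha> v = set_lebesgue_integral lborel {0<..<1} (\<lambda>\<theta>. v \<theta> * omega \<alpha> \<theta>)"

definition bdf_alpha :: "nat \<Rightarrow> real" where
  "bdf_alpha k = [0, 1, 3/2, 11/6, 25/12, 137/60] ! k"

definition bdf_b :: "nat \<Rightarrow> nat \<Rightarrow> real" where
  "bdf_b k j =
    [[],
     [1],
     [2, - 1/2],
     [3, - 3/2, 1/3],
     [4, - 3, 4/3, - 1/4],
     [5, - 5, 10/3, - 5/4, 1/5]] ! k ! j"

text \<open>\<open>bdf_op k u n\<close> is the order-\<open>k\<close> operator producing the value at index \<open>n + 1\<close>; it is only
  meaningful for \<open>k \<le> n + 1\<close>, so that the subtraction \<open>n - j\<close> does not truncate.\<close>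

definition bdf_op :: "nat \<Rightarrow> (nat \<Rightarrow> 'v::real_vector) \<Rightarrow> nat \<Rightarrow> 'v" where
  "bdf_op k u n = bdf_alpha k *\<^sub>R u (n + 1) - (\<Sum>j<k. bdf_b k j *\<^sub>R u (n - j))"

definition bdf_step ::
  "real \<Rightarrow> real \<Rightarrow> real \<Rightarrow> real \<Rightarrow> nat \<Rightarrow> (nat \<Rightarrow> real \<Rightarrow> real) \<Rightarrow> nat \<Rightarrow> bool" where
  "bdf_step \<alpha> lam \<Delta>t \<phi>0 k \<phi> n \<longleftrightarrow>
    (\<forall>\<theta>\<in>{0<..<1}.
      (1 - \<theta>) / \<Delta>t * bdf_op k (\<lambda>m. \<phi> m \<theta>) n + \<theta> * \<phi> (n + 1) \<theta>
        = - lam * C_op \<alpha> (\<phi> (n + 1)) + \<theta> * \<phi>0)"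

text \<open>For orders 3, 4 and 5 the decimals are four-digit values of known multipliers. At exactly \<open>0.2878\<close> the form \<open>(L\<phi>, \<phi> - \<tau>\<phi>)\<close> of order 4 has a slightly negative
  symbol, so no matrix \<open>G\<close> would exist there. Hence the decimals are read up to rounding
  (which includes the decimals themselves).\<close>

definition bdf_tau_decimal :: "nat \<Rightarrow> real" where
  "bdf_tau_decimal k = [0, 0, 0, 0.0836, 0.2878, 0.8160] ! k"

definition is_bdf_tau :: "nat \<Rightarrow> real \<Rightarrow> bool" where
  "is_bdf_tau k \<tau> \<longleftrightarrow>
    (if k \<le> 2 then \<tau> = 0 else \<bar>\<tau> - bdf_tau_decimal k\<bar> \<le> 0.00005)"

definition pos_def_symmetric :: "nat \<Rightarrow> real mat \<Rightarrow> bool" where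
  "pos_def_symmetric k G \<longleftrightarrow>
    G \<in> carrier_mat k k \<and> transpose_mat G = G \<and>
    (\<forall>v\<in>carrier_vec k. v \<noteq> 0\<^sub>v k \<longrightarrow> scalar_prod v (G *\<^sub>v v) > 0)"

text \<open>The entries \<open>g\<^sub>i\<^sub>j\<close>, \<open>1 \<le> i, j \<le> k\<close>, are \<open>G $$ (i - 1, j - 1)\<close>. All indices stay
  nonnegative because \<open>k \<le> n + 1\<close>. The \<open>itself\<close> argument is the inner product space in which
  the sequences live.\<close>

definition multiplier_identity ::
  "'v::real_inner itself \<Rightarrow> nat \<Rightarrow> real \<Rightarrow> real mat \<Rightarrow> (nat \<Rightarrow> real) \<Rightarrow> bool" where
  "multiplier_identity TYPE('v) k \<tau> G \<delta> \<longleftrightarrow>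
    (\<forall>(u :: nat \<Rightarrow> 'v) n. k \<le> n + 1 \<longrightarrow>
      inner (bdf_op k u n) (u (n + 1) - \<tau> *\<^sub>R u n) =
        (\<Sum>i=1..k. \<Sum>j=1..k. G $$ (i - 1, j - 1) * inner (u (n + 1 + i - k)) (u (n + 1 + j - k)))
      - (\<Sum>i=1..k. \<Sum>j=1..k. G $$ (i - 1, j - 1) * inner (u (n + i - k)) (u (n + j - k)))
      + (norm (\<Sum>i=0..k. \<delta> i *\<^sub>R u (n + 1 + i - k)))\<^sup>2)"

text \<open>The identity for real sequences already yields it in every real inner product space, so
  assuming it over the reals is no restriction.\<close>

lemma quadratic_form_transfer:
  fixes c :: "nat \<Rightarrow> nat \<Rightarrow> real" and v :: "nat \<Rightarrow> 'v::real_inner"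
  assumes "\<And>x :: nat \<Rightarrow> real. (\<Sum>i\<le>k. \<Sum>j\<le>k. c i j * (x i * x j)) = 0"
  shows "(\<Sum>i\<le>k. \<Sum>j\<le>k. c i j * inner (v i) (v j)) = 0"
proof -
  have bil: "(\<Sum>i\<le>k. \<Sum>j\<le>k. c i j * (x i * y j)) + (\<Sum>i\<le>k. \<Sum>j\<le>k. c i j * (y i * x j)) = 0"
    for x y :: "nat \<Rightarrow> real"
  proof -
    have "(\<Sum>i\<le>k. \<Sum>j\<le>k. c i j * ((x i + y i) * (x j + y j))) =
      (\<Sum>i\<le>k. \<Sum>j\<le>k. c i j * (x i * x j)) + (\<Sum>i\<le>k. \<Sum>j\<le>k. c i j * (y i * y j))
      + ((\<Sum>i\<le>k. \<Sum>j\<le>k. c i j * (x i * y j)) + (\<Sum>i\<le>k. \<Sum>j\<le>k. c i j * (y i * x j)))"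
      by (simp add: ring_distribs sum.distrib)
    then show ?thesis using assms[of x] assms[of y] assms[of "\<lambda>i. x i + y i"] by simp
  qed
  have pick: "(\<Sum>i\<le>k. \<Sum>j\<le>k. c i j * (of_bool (i = p) * of_bool (j = q))) = c p q"
    if "p \<le> k" "q \<le> k" for p q
  proof -
    have "(\<Sum>i\<le>k. \<Sum>j\<le>k. c i j * (of_bool (i = p) * of_bool (j = q)))
        = (\<Sum>i\<le>k. if i = p then (\<Sum>j\<le>k. if j = q then c i j else 0) else 0)"
      by (intro sum.cong refl) (auto intro!: sum.cong)
    then show ?thesis using that by simp
  qed
  have anti: "c q p = - c p q" if "p \<le> k" "q \<le> k" for p q
    using bil[of "\<lambda>i. of_bool (i = p)" "\<lambda>i. of_bool (i = q)"] pick[OF that] pick[OF that(2,1)]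
    by simp
  let ?S = "\<Sum>i\<le>k. \<Sum>j\<le>k. c i j * inner (v i) (v j)"
  have "?S = (\<Sum>j\<le>k. \<Sum>i\<le>k. c i j * inner (v i) (v j))" by (rule sum.swap)
  also have "\<dots> = (\<Sum>j\<le>k. \<Sum>i\<le>k. - (c j i * inner (v j) (v i)))"
  proof (intro sum.cong refl)
    fix i j assume "j \<in> {..k}" "i \<in> {..k}"
    then have "c i j = - c j i" by (intro anti) auto
    moreover have "inner (v i) (v j) = inner (v j) (v i)" by (rule inner_commute)
    ultimately show "c i j * inner (v i) (v j) = - (c j i * inner (v j) (v i))"
      by (metis mult_minus_left)
  qed
  also have "\<dots> = - ?S" by (simp add: sum_negf)
  finally show ?thesis by simp
qed

lemma multiplier_identity_real_imp_all:
  assumes id: "multiplier_identity TYPE(real) k \<tau> G \<delta>" and k: "k \<ge> 1"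
  shows "multiplier_identity TYPE('v::real_inner) k \<tau> G \<delta>"
proof -
  define a where "a i = (if i = k then bdf_alpha k else - bdf_b k (k - 1 - i))" for i
  define m where "m i = (if i = k then 1 else if i = k - 1 then - \<tau> else 0)" for i
  define g where "g i j = (if i \<ge> 1 \<and> j \<ge> 1 then G $$ (i - 1, j - 1) else 0)" for i j
  define h where "h i j = (if i < k \<and> j < k then G $$ (i, j) else 0)" for i j
  define c where "c i j = a i * m j - (g i j - h i j + \<delta> i * \<delta> j)" for i j
  have key: "inner (bdf_op k u n) (u (n + 1) - \<tau> *\<^sub>R u n) -
      ((\<Sum>i=1..k. \<Sum>j=1..k. G $$ (i - 1, j - 1) * inner (u (n + 1 + i - k)) (u (n + 1 + j - k)))
      - (\<Sum>i=1..k. \<Sum>j=1..k. G $$ (i - 1, j - 1) * inner (u (n + i - k)) (u (n + j - k)))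
      + (norm (\<Sum>i=0..k. \<delta> i *\<^sub>R u (n + 1 + i - k)))\<^sup>2)
    = (\<Sum>i\<le>k. \<Sum>j\<le>k. c i j * inner (u (n + 1 + i - k)) (u (n + 1 + j - k)))"
    if n: "k \<le> n + 1" for u :: "nat \<Rightarrow> 'w::real_inner" and n
  proof -
    let ?w = "\<lambda>i. u (n + 1 + i - k)"
    have bilin: "inner (\<Sum>i\<le>k. p i *\<^sub>R ?w i) (\<Sum>j\<le>k. q j *\<^sub>R ?w j)
        = (\<Sum>i\<le>k. \<Sum>j\<le>k. p i * q j * inner (?w i) (?w j))" for p q
      unfolding inner_sum_left
      unfolding inner_sum_right by (simp add: mult.assoc mult.left_commute)
    have atMost: "{..k} = insert k {..<k}" by auto
    have "(\<Sum>j<k. bdf_b k j *\<^sub>R u (n - j)) = (\<Sum>i<k. bdf_b k (k - 1 - i) *\<^sub>R ?w i)"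
      by (rule sum.reindex_bij_witness[of _ "\<lambda>i. k - 1 - i" "\<lambda>i. k - 1 - i"])
        (use n in \<open>auto intro!: arg_cong[of _ _ u]\<close>)
    then have L: "bdf_op k u n = (\<Sum>i\<le>k. a i *\<^sub>R ?w i)"
      unfolding bdf_op_def atMost by (simp add: a_def sum_negf)
    have "(\<Sum>i\<le>k. m i *\<^sub>R ?w i) = (\<Sum>i\<in>{k - 1, k}. m i *\<^sub>R ?w i)"
      by (rule sum.mono_neutral_right) (auto simp: m_def)
    also have "\<dots> = u (n + 1) - \<tau> *\<^sub>R u n"
    proof -
      have "k - Suc 0 \<noteq> k" using k by arith
      then show ?thesis using k by (simp add: m_def)
    qed
    finally have M: "u (n + 1) - \<tau> *\<^sub>R u n = (\<Sum>i\<le>k. m i *\<^sub>R ?w i)" by simp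
    have 1: "inner (bdf_op k u n) (u (n + 1) - \<tau> *\<^sub>R u n)
        = (\<Sum>i\<le>k. \<Sum>j\<le>k. a i * m j * inner (?w i) (?w j))"
      unfolding L M by (rule bilin)
    have 2: "(\<Sum>i=1..k. \<Sum>j=1..k. G $$ (i - 1, j - 1) * inner (?w i) (?w j))
        = (\<Sum>i\<le>k. \<Sum>j\<le>k. g i j * inner (?w i) (?w j))"
    proof -
      have "(\<Sum>i\<le>k. \<Sum>j\<le>k. g i j * inner (?w i) (?w j))
          = (\<Sum>i=1..k. \<Sum>j\<le>k. g i j * inner (?w i) (?w j))"
        by (rule sum.mono_neutral_right) (auto simp: g_def)
      also have "\<dots> = (\<Sum>i=1..k. \<Sum>j=1..k. g i j * inner (?w i) (?w j))"
        by (intro sum.cong refl sum.mono_neutral_right) (auto simp: g_def)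
      also have "\<dots> = (\<Sum>i=1..k. \<Sum>j=1..k. G $$ (i - 1, j - 1) * inner (?w i) (?w j))"
        by (intro sum.cong refl) (auto simp: g_def)
      finally show ?thesis by simp
    qed
    have shift: "(\<Sum>i=1..k. f (i - 1)) = (\<Sum>i<k. f i)" for f :: "nat \<Rightarrow> real"
      by (rule sum.reindex_bij_witness[of _ Suc "\<lambda>i. i - 1"]) auto
    have 3: "(\<Sum>i=1..k. \<Sum>j=1..k. G $$ (i - 1, j - 1) * inner (u (n + i - k)) (u (n + j - k)))
        = (\<Sum>i\<le>k. \<Sum>j\<le>k. h i j * inner (?w i) (?w j))"
    proof -
      have "(\<Sum>i=1..k. \<Sum>j=1..k. G $$ (i - 1, j - 1) * inner (u (n + i - k)) (u (n + j - k)))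
          = (\<Sum>i=1..k. \<Sum>j=1..k. G $$ (i - 1, j - 1) * inner (?w (i - 1)) (?w (j - 1)))"
        by (intro sum.cong refl) auto
      also have "\<dots> = (\<Sum>i<k. \<Sum>j<k. G $$ (i, j) * inner (?w i) (?w j))"
        unfolding shift[where f = "\<lambda>j. G $$ (_, j) * inner _ (?w j)"]
        by (rule shift)
      also have "\<dots> = (\<Sum>i<k. \<Sum>j<k. h i j * inner (?w i) (?w j))"
        by (intro sum.cong refl) (auto simp: h_def)
      also have "\<dots> = (\<Sum>i\<le>k. \<Sum>j\<le>k. h i j * inner (?w i) (?w j))"
        unfolding atMost by (simp add: h_def)
      finally show ?thesis .
    qed
    have 4: "(norm (\<Sum>i=0..k. \<delta> i *\<^sub>R ?w i))\<^sup>2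
        = (\<Sum>i\<le>k. \<Sum>j\<le>k. \<delta> i * \<delta> j * inner (?w i) (?w j))"
      unfolding power2_norm_eq_inner atLeast0AtMost by (rule bilin)
    show ?thesis
      unfolding 1 2 3 4 c_def
      by (simp add: left_diff_distrib distrib_right sum.distrib sum_subtractf)
  qed
  have zero: "(\<Sum>i\<le>k. \<Sum>j\<le>k. c i j * (x i * x j)) = 0" for x :: "nat \<Rightarrow> real"
  proof -
    have "k \<le> (k - 1) + 1" using k by simp
    from key[OF this, of x] id[unfolded multiplier_identity_def, rule_format, OF this, of x]
    have "(\<Sum>i\<le>k. \<Sum>j\<le>k. c i j * inner (x (k - 1 + 1 + i - k)) (x (k - 1 + 1 + j - k))) = 0"
      by linarith
    then show ?thesis using k by simp
  qed
  show ?thesis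
    unfolding multiplier_identity_def
  proof (intro allI impI)
    fix u :: "nat \<Rightarrow> 'v" and n assume n: "k \<le> n + 1"
    from key[OF n, of u] quadratic_form_transfer[OF zero, of "\<lambda>i. u (n + 1 + i - k)"]
    show "inner (bdf_op k u n) (u (n + 1) - \<tau> *\<^sub>R u n) =
        (\<Sum>i=1..k. \<Sum>j=1..k. G $$ (i - 1, j - 1) * inner (u (n + 1 + i - k)) (u (n + 1 + j - k)))
      - (\<Sum>i=1..k. \<Sum>j=1..k. G $$ (i - 1, j - 1) * inner (u (n + i - k)) (u (n + j - k)))
      + (norm (\<Sum>i=0..k. \<delta> i *\<^sub>R u (n + 1 + i - k)))\<^sup>2"
      by linarith
  qed
qed

definition lambda_min :: "real mat \<Rightarrow> real" where
  "lambda_min G = Min (spectrum G)"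

definition lambda_max :: "real mat \<Rightarrow> real" where
  "lambda_max G = Max (spectrum G)"

end

theory Submission
  imports Defs
begin

text \<open>
  Testing the scheme with \<open>\<phi>\<^sup>n\<^sup>+\<^sup>1 - \<tau>\<phi>\<^sup>n\<close> turns the multiplier identity into a telescoping estimate for
  the \<open>G\<close>-energy, and \<open>a (a - \<tau>b) \<ge> (a\<^sup>2 - \<tau>\<^sup>2b\<^sup>2)/2\<close> handles the remaining terms. What is left is the
  energy of the starting values \<open>\<phi>\<^sup>0, \<dots>, \<phi>\<^sup>k\<^sup>-\<^sup>1\<close>. Bounding it by \<open>\<lambda>\<^sub>m\<^sub>a\<^sub>x\<close> times the sum of their squared
  norms loses too much. Instead, prolong the sequence by \<open>\<phi>\<^sup>0\<close> to negative times: the constant state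
  has energy \<open>(1 - \<tau>)/2 |\<phi>\<^sup>0|\<^sup>2\<close>, so the energy of the starting values is at most this plus the
  \<open>k - 1\<close> supplies of the order-\<open>k\<close> operator. Each starting step of order \<open>j\<close> is then tested with a
  combination \<open>p \<phi>\<^sup>j + q \<phi>\<^sup>j\<^sup>-\<^sup>1\<close> chosen such that the resulting quadratic forms are nonnegative.
  The constants fit because \<open>\<lambda>\<^sub>m\<^sub>a\<^sub>x\<close> is bounded below: \<open>G 1\<close> is \<open>(1 - \<tau>)/2\<close> times the linear functional
  conserved by \<open>L u = 0\<close>, and Cauchy--Schwarz bounds the energy below by the square of this functional.
  All estimates are pointwise in \<open>\<theta>\<close> and are integrated against \<open>\<omega>\<^sub>\<alpha>\<close> once, at the end.
\<close>

section \<open>Rayleigh quotients\<close>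

text \<open>A maximizer of the form on the unit sphere exists by compactness, and the vanishing
  first variation there is the eigenvalue equation. Vectors are functions on the naturals of which
  only the first \<open>k\<close> values count.\<close>

lemma symmetric_form_max_eigenvector:
  fixes a :: "nat \<Rightarrow> nat \<Rightarrow> real"
  assumes k: "k \<ge> 1" and sym: "\<And>i j. i < k \<Longrightarrow> j < k \<Longrightarrow> a i j = a j i"
  obtains \<mu> v where "\<exists>i<k. v i \<noteq> 0" "\<And>i. i < k \<Longrightarrow> (\<Sum>j<k. a i j * v j) = \<mu> * v i"
    "\<And>w. (\<Sum>i<k. \<Sum>j<k. a i j * (w i * w j)) \<le> \<mu> * (\<Sum>i<k. (w i)\<^sup>2)"
proof -
  define q where "q w = (\<Sum>i<k. \<Sum>j<k. a i j * (w i * w j))" for w :: "nat \<Rightarrow> real"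
  define s where "s w = (\<Sum>i<k. (w i)\<^sup>2)" for w :: "nat \<Rightarrow> real"
  have cont_s: "continuous_on UNIV s" and cont_q: "continuous_on UNIV q"
    unfolding s_def q_def by (intro continuous_intros; simp)+
  \<comment> \<open>Coordinates from \<open>k\<close> on are pinned to 0, so the box is a product of
    compact sets and compact by Tychonoff; the sphere is a closed part of it.\<close>
  define S where "S = PiE UNIV (\<lambda>i. if i < k then {-1..1} else {0 :: real}) \<inter> {w. s w = 1}"
  have "compactin (product_topology (\<lambda>i::nat. euclidean) UNIV)
      (PiE UNIV (\<lambda>i. if i < k then {-1..1} else {0 :: real}))"
    unfolding compactin_PiE by auto
  then have "compact (PiE UNIV (\<lambda>i. if i < k then {-1..1} else {0 :: real}))"
    unfolding euclidean_product_topology compactin_euclidean_iff .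
  then have "compact S"
    unfolding S_def by (intro compact_Int_closed closed_Collect_eq cont_s continuous_on_const)
  moreover have "(\<lambda>i. if i = 0 then 1 else 0) \<in> S"
  proof -
    have "s (\<lambda>i. if i = 0 then 1 else 0) = (\<Sum>i<k. if i = 0 then 1 else 0)"
      unfolding s_def by (intro sum.cong) auto
    then show ?thesis using k by (auto simp: S_def)
  qed
  ultimately obtain v where v: "v \<in> S" and vmax: "\<And>w. w \<in> S \<Longrightarrow> q w \<le> q v"
    using continuous_attains_sup[of S q] continuous_on_subset[OF cont_q, of S] by blast
  define \<mu> where "\<mu> = q v"
  have sv: "s v = 1" using v by (simp add: S_def)
  have le: "q w \<le> \<mu> * s w" for w
  proof (cases "s w = 0")
    case True
    then have "w i = 0" if "i < k" for i
      using that by (simp add: s_def sum_nonneg_eq_0_iff)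
    then show ?thesis using True by (simp add: q_def)
  next
    case False
    moreover have "s w \<ge> 0" by (simp add: s_def sum_nonneg)
    ultimately have pos: "s w > 0" by simp
    define u where "u i = (if i < k then w i / sqrt (s w) else 0)" for i
    have su: "s u = 1"
      using pos by (simp add: s_def u_def power_divide flip: sum_divide_distrib)
    moreover have "\<bar>u i\<bar> \<le> 1" if "i < k" for i
    proof -
      have "(u i)\<^sup>2 \<le> s u" unfolding s_def using that by (intro member_le_sum) auto
      then show ?thesis using su by (simp add: abs_square_le_1)
    qed
    then have "u i \<in> (if i < k then {-1..1} else {0})" for i
      by (cases "i < k") (auto simp: abs_le_iff u_def simp del: abs_divide)
    ultimately have "u \<in> S" by (auto simp: S_def)
    then have "q u \<le> \<mu>" using vmax by (simp add: \<mu>_def)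
    moreover have "q u = q w / s w"
      using pos by (simp add: q_def u_def sum_divide_distrib flip: power2_eq_square)
    ultimately show ?thesis using pos by (simp add: field_simps)
  qed
  have eigen: "(\<Sum>j<k. a i j * v j) = \<mu> * v i" if i: "i < k" for i
  proof -
    define c where "c = (\<Sum>j<k. a i j * v j) - \<mu> * v i"
    \<comment> \<open>The maximizer is perturbed by \<open>t\<close> times the \<open>i\<close>-th
      unit vector. Terms of order zero cancel, and the linear term is bounded by a quadratic one for
      every real \<open>t\<close>.\<close>
    have exp: "2 * t * c \<le> t\<^sup>2 * (\<mu> - a i i)" for t
    proof -
      define e :: "nat \<Rightarrow> real" where "e j = of_bool (j = i)" for j
      let ?w = "\<lambda>j. v j + t * e j"
      have 1: "(\<Sum>j<k. f j * e j) = f i" for f :: "nat \<Rightarrow> real"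
      proof -
        have "(\<Sum>j<k. f j * e j) = (\<Sum>j<k. if j = i then f j else 0)"
          by (intro sum.cong) (auto simp: e_def)
        then show ?thesis using i by simp
      qed
      have "q ?w = q v + t * (\<Sum>l<k. (\<Sum>j<k. a l j * v j) * e l)
          + t * (\<Sum>l<k. v l * (\<Sum>j<k. a l j * e j))
          + t\<^sup>2 * (\<Sum>l<k. (\<Sum>j<k. a l j * e j) * e l)"
        by (simp add: q_def distrib_left distrib_right sum.distrib sum_distrib_left
            sum_distrib_right power2_eq_square mult_ac)
      also have "\<dots> = q v + t * (\<Sum>j<k. a i j * v j) + t * (\<Sum>l<k. v l * a l i) + t\<^sup>2 * a i i"
        unfolding 1 ..
      also have "(\<Sum>l<k. v l * a l i) = (\<Sum>j<k. a i j * v j)"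
        by (intro sum.cong) (simp_all add: sym[OF _ i] mult.commute)
      finally have qw: "q ?w = \<mu> + 2 * t * (\<Sum>j<k. a i j * v j) + t\<^sup>2 * a i i"
        unfolding \<mu>_def by linarith
      have "s ?w = s v + 2 * t * (\<Sum>j<k. v j * e j) + t\<^sup>2 * (\<Sum>j<k. e j * e j)"
        by (simp add: s_def power2_eq_square distrib_left distrib_right sum.distrib
            sum_distrib_left mult_ac)
      then have sw: "s ?w = 1 + 2 * t * v i + t\<^sup>2"
        unfolding 1 sv by (simp add: e_def[of i])
      have "q ?w \<le> \<mu> * s ?w" by (rule le)
      then show ?thesis
        unfolding qw sw c_def by (simp add: algebra_simps)
    qed
    have "c = 0"
    proof (rule ccontr)
      assume "c \<noteq> 0"
      \<comment> \<open>With \<open>t = c / d\<close> and \<open>d\<close> above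
        \<open>\<mu> - a i i\<close> the bound reads 2 c^2 / d \<le> c^2 / d, which is impossible
        for nonzero \<open>c\<close>.\<close>
      define d where "d = \<bar>\<mu> - a i i\<bar> + 1"
      have d: "d > 0" "\<mu> - a i i \<le> d" by (auto simp: d_def)
      have "2 * (c / d) * c \<le> (c / d)\<^sup>2 * (\<mu> - a i i)" by (rule exp)
      also have "\<dots> \<le> (c / d)\<^sup>2 * d" using d by (intro mult_left_mono) auto
      finally have "2 * c\<^sup>2 / d \<le> c\<^sup>2 / d" using d by (simp add: power2_eq_square)
      moreover have "c\<^sup>2 / d > 0" using d \<open>c \<noteq> 0\<close> by simp
      ultimately show False by simp
    qed
    then show ?thesis by (simp add: c_def)
  qed
  have "\<exists>i<k. v i \<noteq> 0"
  proof (rule ccontr)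
    assume "\<not> ?thesis"
    then have "s v = 0" by (simp add: s_def)
    with sv show False by simp
  qed
  then show ?thesis
    using that[of v \<mu>] eigen le unfolding q_def s_def by simp
qed

definition qform :: "nat \<Rightarrow> real mat \<Rightarrow> (nat \<Rightarrow> real) \<Rightarrow> real" where
  "qform k G v = (\<Sum>i<k. \<Sum>j<k. G $$ (i, j) * (v i * v j))"

lemma eigenvalue_mat_funI:
  assumes G: "G \<in> carrier_mat k k" and "\<exists>i<k. v i \<noteq> (0 :: real)"
    and "\<And>i. i < k \<Longrightarrow> (\<Sum>j<k. G $$ (i, j) * v j) = \<mu> * v i"
  shows "\<mu> \<in> spectrum G"
proof -
  have "eigenvector G (vec k v) \<mu>"
    unfolding eigenvector_def
  proof (intro conjI)
    show "vec k v \<in> carrier_vec (dim_row G)" using G by simp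
    show "vec k v \<noteq> 0\<^sub>v (dim_row G)"
      using G assms(2) by (auto simp: vec_eq_iff)
    show "G *\<^sub>v vec k v = \<mu> \<cdot>\<^sub>v vec k v"
      using G assms(3) by (intro eq_vecI) (auto simp: scalar_prod_def atLeast0LessThan)
  qed
  then show ?thesis by (auto simp: spectrum_def eigenvalue_def)
qed

text \<open>The maximum of the form on the sphere is an eigenvalue, hence at most
  \<open>lambda_max G\<close>; the minimum is treated as the maximum of the negated form. Finiteness
  of the spectrum makes \<open>Min\<close> and \<open>Max\<close> meaningful.\<close>

lemma rayleigh_bounds:
  assumes G: "G \<in> carrier_mat k k" "transpose_mat G = G" and k: "k \<ge> 1"
  shows "qform k G w \<le> lambda_max G * (\<Sum>i<k. (w i)\<^sup>2)"
    and "lambda_min G * (\<Sum>i<k. (w i)\<^sup>2) \<le> qform k G w"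
    and "lambda_min G \<in> spectrum G"
proof -
  have sym: "G $$ (i, j) = G $$ (j, i)" if "i < k" "j < k" for i j
    using arg_cong[OF G(2), of "\<lambda>A. A $$ (j, i)"] G(1) that by simp
  have s0: "(\<Sum>i<k. (w i)\<^sup>2) \<ge> 0" by (simp add: sum_nonneg)
  have fin: "finite (spectrum G)" using card_finite_spectrum[OF G(1)] by simp
  obtain \<mu> v where v: "\<exists>i<k. v i \<noteq> 0" "\<And>i. i < k \<Longrightarrow> (\<Sum>j<k. G $$ (i, j) * v j) = \<mu> * v i"
    "\<And>w. (\<Sum>i<k. \<Sum>j<k. G $$ (i, j) * (w i * w j)) \<le> \<mu> * (\<Sum>i<k. (w i)\<^sup>2)"
    by (rule symmetric_form_max_eigenvector[OF k, of "\<lambda>i j. G $$ (i, j)"]) (rule sym, assumption+, blast)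
  have "\<mu> \<in> spectrum G" using G v by (intro eigenvalue_mat_funI[where v = v]) auto
  then have "\<mu> \<le> lambda_max G" using fin by (simp add: lambda_max_def)
  then show "qform k G w \<le> lambda_max G * (\<Sum>i<k. (w i)\<^sup>2)"
    unfolding qform_def using v(3)[of w] mult_right_mono[OF _ s0, of \<mu> "lambda_max G"] by linarith
  obtain \<nu> u where u: "\<exists>i<k. u i \<noteq> 0" "\<And>i. i < k \<Longrightarrow> (\<Sum>j<k. - G $$ (i, j) * u j) = \<nu> * u i"
    "\<And>w. (\<Sum>i<k. \<Sum>j<k. - G $$ (i, j) * (w i * w j)) \<le> \<nu> * (\<Sum>i<k. (w i)\<^sup>2)"
    by (rule symmetric_form_max_eigenvector[OF k, of "\<lambda>i j. - G $$ (i, j)"])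
      (simp only: neg_equal_iff_equal, rule sym, assumption+, blast)
  have "(\<Sum>j<k. G $$ (i, j) * u j) = - \<nu> * u i" if "i < k" for i
    using u(2)[OF that] by (simp add: sum_negf)
  then have in_spec: "- \<nu> \<in> spectrum G" using G u(1) by (intro eigenvalue_mat_funI[where v = u]) auto
  then have "lambda_min G \<le> - \<nu>" using fin by (simp add: lambda_min_def)
  then have "lambda_min G * (\<Sum>i<k. (w i)\<^sup>2) \<le> - \<nu> * (\<Sum>i<k. (w i)\<^sup>2)"
    by (rule mult_right_mono[OF _ s0])
  also have "\<dots> \<le> qform k G w" using u(3)[of w] by (simp add: qform_def sum_negf)
  finally show "lambda_min G * (\<Sum>i<k. (w i)\<^sup>2) \<le> qform k G w" .
  show "lambda_min G \<in> spectrum G"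
    unfolding lambda_min_def using fin in_spec by (intro Min_in) auto
qed

lemma scalar_prod_mat_qform:
  assumes "G \<in> carrier_mat k k" "v \<in> carrier_vec k"
  shows "scalar_prod v (G *\<^sub>v v) = qform k G (\<lambda>i. v $ i)"
proof -
  have "scalar_prod v (G *\<^sub>v v) = (\<Sum>i<k. v $ i * (\<Sum>j<k. G $$ (i, j) * v $ j))"
    using assms by (simp add: scalar_prod_def atLeast0LessThan)
  then show ?thesis by (simp add: qform_def sum_distrib_left mult_ac)
qed

lemma pos_def_qform_nonneg:
  assumes "pos_def_symmetric k G"
  shows "qform k G w \<ge> 0"
proof -
  have G: "G \<in> carrier_mat k k" using assms by (simp add: pos_def_symmetric_def)
  have "scalar_prod (vec k w) (G *\<^sub>v vec k w) \<ge> 0"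
  proof (cases "vec k w = 0\<^sub>v k")
    case True
    then show ?thesis by (simp add: scalar_prod_def)
  next
    case False
    moreover have "vec k w \<in> carrier_vec k" by simp
    ultimately show ?thesis using assms unfolding pos_def_symmetric_def by (metis less_imp_le)
  qed
  also have "scalar_prod (vec k w) (G *\<^sub>v vec k w) = qform k G (\<lambda>i. vec k w $ i)"
    using G by (intro scalar_prod_mat_qform) simp_all
  also have "\<dots> = qform k G w"
    unfolding qform_def by (intro sum.cong) auto
  finally show ?thesis .
qed

text \<open>At an eigenvector the form is the eigenvalue times a squared norm. The sign is used in
  \<open>pointwise_stability\<close>, where all but one entry of the window are discarded.\<close>

lemma pos_def_lambda_min_nonneg:
  assumes "pos_def_symmetric k G" "k \<ge> 1"
  shows "lambda_min G \<ge> 0"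
proof -
  have G: "G \<in> carrier_mat k k" "transpose_mat G = G"
    using assms(1) unfolding pos_def_symmetric_def by blast+
  have "eigenvalue G (lambda_min G)"
    using rayleigh_bounds(3)[OF G assms(2)] unfolding spectrum_def by (rule CollectD)
  moreover have "dim_row G = k" using G(1) by (rule carrier_matD(1))
  ultimately obtain v where v: "v \<in> carrier_vec k" "v \<noteq> 0\<^sub>v k" "G *\<^sub>v v = lambda_min G \<cdot>\<^sub>v v"
    unfolding eigenvalue_def eigenvector_def by metis
  have "0 < scalar_prod v (G *\<^sub>v v)"
    using assms(1) v(1,2) unfolding pos_def_symmetric_def by (metis (no_types))
  then have "0 < scalar_prod v (lambda_min G \<cdot>\<^sub>v v)"
    by (simp only: v(3))
  then have "0 < lambda_min G * scalar_prod v v"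
    by (simp only: scalar_prod_smult_distrib[OF v(1) v(1)])
  moreover have "scalar_prod v v \<ge> 0"
    unfolding scalar_prod_def by (rule sum_nonneg) simp
  ultimately show ?thesis unfolding zero_less_mult_iff by linarith
qed

section \<open>Energy of BDF sequences\<close>

text \<open>The window consists of the \<open>k\<close> values ending in \<open>x n\<close>; for
  \<open>k \<le> n + 1\<close> the subtraction does not truncate.\<close>

definition energy :: "nat \<Rightarrow> real mat \<Rightarrow> nat \<Rightarrow> (nat \<Rightarrow> real) \<Rightarrow> real" where
  "energy k G n x = qform k G (\<lambda>i. x (n + 1 + i - k))"

lemma energy_cong:
  assumes "\<And>i. i < k \<Longrightarrow> x (n + 1 + i - k) = y (m + 1 + i - k)"
  shows "energy k G n x = energy k G m y"
  unfolding energy_def qform_def using assms by (intro sum.cong) auto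

lemma sum_1_eq_lessThan: "(\<Sum>i=1..k. f i) = (\<Sum>i<k. f (Suc i))"
  by (rule sum.reindex_bij_witness[of _ Suc "\<lambda>i. i - 1"]) auto

lemma multiplier_energy_identity:
  assumes "multiplier_identity TYPE(real) k \<tau> G \<delta>" and "k \<le> n + 1"
  shows "bdf_op k x n * (x (n + 1) - \<tau> * x n) =
    energy k G (n + 1) x - energy k G n x + (\<Sum>i\<le>k. \<delta> i * x (n + 1 + i - k))\<^sup>2"
  using assms unfolding multiplier_identity_def energy_def qform_def sum_1_eq_lessThan
  by (simp add: atLeast0AtMost)

lemma bdf_op_linear: "bdf_op k (\<lambda>m. a * x m + b * y m) n = a * bdf_op k x n + b * bdf_op k y n"
  for x y :: "nat \<Rightarrow> real"
  by (simp add: bdf_op_def algebra_simps sum.distrib sum_distrib_left)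

lemma bdf_order_cases:
  assumes "1 \<le> k" "k \<le> (5 :: nat)"
  obtains "k = 1" | "k = 2" | "k = 3" | "k = 4" | "k = 5"
  using assms by linarith

text \<open>Order one is written with \<open>Suc 0\<close>, the form to which the simplifier
  rewrites 1.\<close>

lemma bdf_op_1: "bdf_op (Suc 0) x n = x (Suc n) - x n"
  and bdf_op_2: "bdf_op 2 x n = 3/2 * x (Suc n) - 2 * x n + 1/2 * x (n - 1)"
  and bdf_op_3: "bdf_op 3 x n = 11/6 * x (Suc n) - 3 * x n + 3/2 * x (n - 1) - 1/3 * x (n - 2)"
  and bdf_op_4: "bdf_op 4 x n = 25/12 * x (Suc n) - 4 * x n + 3 * x (n - 1) - 4/3 * x (n - 2)
    + 1/4 * x (n - 3)"
  and bdf_op_5: "bdf_op 5 x n = 137/60 * x (Suc n) - 5 * x n + 5 * x (n - 1) - 10/3 * x (n - 2)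
    + 5/4 * x (n - 3) - 1/5 * x (n - 4)"
  for x :: "nat \<Rightarrow> real"
  by (simp_all add: bdf_op_def bdf_alpha_def bdf_b_def numeral_eq_Suc)

lemmas bdf_ops = bdf_op_1 bdf_op_2 bdf_op_3 bdf_op_4 bdf_op_5

lemma bdf_op_const:
  assumes "1 \<le> k" "k \<le> 5"
  shows "bdf_op k (\<lambda>_. c :: real) n = 0"
  using assms by (cases rule: bdf_order_cases) (simp_all add: bdf_ops)

section \<open>Scalar consequences of the multiplier identity\<close>

locale bdf_multiplier =
  fixes k :: nat and \<tau> :: real and G :: "real mat" and \<delta> :: "nat \<Rightarrow> real"
  assumes order: "1 \<le> k" "k \<le> 5"
    and pos: "pos_def_symmetric k G"
    and identity: "multiplier_identity TYPE(real) k \<tau> G \<delta>"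
begin

lemma symmetric: "i < k \<Longrightarrow> j < k \<Longrightarrow> G $$ (i, j) = G $$ (j, i)"
  using pos unfolding pos_def_symmetric_def
  by (metis carrier_matD index_transpose_mat(1))

lemma energy_step:
  assumes "k \<le> n + 1"
  shows "energy k G (n + 1) x - energy k G n x \<le> bdf_op k x n * (x (n + 1) - \<tau> * x n)"
  using multiplier_energy_identity[OF identity assms, of x] by simp

lemma energy_le_telescoped:
  assumes "k \<le> m + 1"
  shows "energy k G (m + d) x \<le> energy k G m x
    + (\<Sum>i<d. bdf_op k x (m + i) * (x (m + i + 1) - \<tau> * x (m + i)))"
proof (induction d)
  case (Suc d)
  then show ?case using energy_step[of "m + d" x] assms by simp
qed simp

text \<open>On the constant sequence 1 the operator vanishes and both energies agree, so only the
  square of this sum is left in the identity.\<close>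

lemma sum_delta_0: "(\<Sum>i\<le>k. \<delta> i) = 0"
  using multiplier_energy_identity[OF identity, of k "\<lambda>_. 1"] order
  by (simp add: bdf_op_const energy_cong[of k "\<lambda>_. 1" "Suc k" "\<lambda>_. 1" k])

text \<open>The bilinear form of \<open>G\<close> between the constant sequence 1 and the window. By
  \<open>pairing_step\<close> it stays constant wherever \<open>bdf_op\<close> vanishes.\<close>

definition pairing :: "nat \<Rightarrow> (nat \<Rightarrow> real) \<Rightarrow> real" where
  "pairing n x = (\<Sum>i<k. \<Sum>j<k. G $$ (i, j) * x (n + 1 + j - k))"

text \<open>Symmetry of \<open>G\<close> merges the two mixed terms of the expansion into one
  \<open>pairing\<close>.\<close>

lemma energy_affine:
  "energy k G n (\<lambda>m. a + b * x m)
    = a\<^sup>2 * energy k G n (\<lambda>_. 1) + 2 * a * b * pairing n x + b\<^sup>2 * energy k G n x"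
proof -
  have "pairing n x = (\<Sum>i<k. \<Sum>j<k. G $$ (i, j) * x (n + 1 + i - k))"
    unfolding pairing_def by (subst sum.swap) (intro sum.cong refl, simp add: symmetric)
  then have "2 * a * b * pairing n x = a * b * (\<Sum>i<k. \<Sum>j<k. G $$ (i, j) * x (n + 1 + i - k))
      + a * b * (\<Sum>i<k. \<Sum>j<k. G $$ (i, j) * x (n + 1 + j - k))"
    unfolding pairing_def by simp
  then show ?thesis
    unfolding energy_def qform_def
    by (simp add: power2_eq_square distrib_left distrib_right sum.distrib sum_distrib_left mult_ac)
qed

text \<open>The part of the multiplier identity at \<open>a + x\<close> that is linear in the constant \<open>a\<close>.\<close>

lemma pairing_step:
  assumes "k \<le> n + 1"
  shows "2 * (pairing (n + 1) x - pairing n x) = (1 - \<tau>) * bdf_op k x n"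
proof -
  have const: "energy k G (n + 1) (\<lambda>_. 1) = energy k G n (\<lambda>_. 1)"
    by (rule energy_cong) simp
  have affine: "bdf_op k x n * ((1 + x (n + 1)) - \<tau> * (1 + x n)) =
    energy k G (n + 1) x + 2 * pairing (n + 1) x - energy k G n x - 2 * pairing n x
      + (\<Sum>i\<le>k. \<delta> i * x (n + 1 + i - k))\<^sup>2"
  proof -
    have "bdf_op k (\<lambda>m. 1 + x m) n = bdf_op k x n"
      using bdf_op_linear[of k 1 "\<lambda>_. 1" 1 x n] bdf_op_const[OF order, of 1 n] by simp
    moreover have "(\<Sum>i\<le>k. \<delta> i * (1 + x (n + 1 + i - k))) = (\<Sum>i\<le>k. \<delta> i * x (n + 1 + i - k))"
      by (simp add: distrib_left sum.distrib sum_delta_0)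
    ultimately show ?thesis
      using multiplier_energy_identity[OF identity assms, of "\<lambda>m. 1 + x m"] const
        energy_affine[of n 1 1 x] energy_affine[of "n + 1" 1 1 x] by simp
  qed
  show ?thesis
    using affine multiplier_energy_identity[OF identity assms, of x]
    by (simp add: algebra_simps)
qed

lemma pairing_telescoped:
  assumes "k \<le> m + 1"
  shows "2 * (pairing (m + d) x - pairing m x) = (1 - \<tau>) * (\<Sum>i<d. bdf_op k x (m + i))"
proof (induction d)
  case (Suc d)
  then show ?case using pairing_step[of "m + d" x] assms by (simp add: algebra_simps)
qed simp

text \<open>The window ending at index \<open>k - 1\<close> is zero, and the one \<open>k\<close>
  steps later holds exactly \<open>x k\<close> up to \<open>x (2 * k - 1)\<close>. So an arbitrary
  window is reached from the zero state, and its pairing is governed by the total of the operator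
  values on the way.\<close>

lemma pairing_window:
  assumes "\<And>m. m < k \<Longrightarrow> x m = 0"
  shows "2 * pairing (k - 1 + k) x = (1 - \<tau>) * (\<Sum>i<k. bdf_op k x (k - 1 + i))"
proof -
  have "pairing (k - 1) x = 0"
    unfolding pairing_def using assms order by (intro sum.neutral ballI) auto
  then show ?thesis using pairing_telescoped[of "k - 1" k x] order by simp
qed

lemma energy_const: "energy k G n (\<lambda>_. c) = (1 - \<tau>) / 2 * c\<^sup>2"
proof -
  \<comment> \<open>A jump from 0 to 1: its final window is constantly 1, and by first-order
    consistency the operator values along the jump add up to 1.\<close>
  let ?x = "\<lambda>m. if m < k then 0 else 1 :: real"
  have "(\<Sum>i<k. bdf_op k ?x (k - 1 + i)) = 1"
    using order by (cases rule: bdf_order_cases) (simp_all add: bdf_ops lessThan_nat_numeral)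
  then have "pairing (k - 1 + k) ?x = (1 - \<tau>) / 2"
    using pairing_window[of ?x] by simp
  moreover have "pairing (k - 1 + k) ?x = energy k G n (\<lambda>_. 1)"
    unfolding pairing_def energy_def qform_def by (intro sum.cong) auto
  ultimately show ?thesis using energy_affine[of n c 0 "\<lambda>_. 0"] by simp
qed

text \<open>The energy of \<open>x - s\<close> is nonnegative, where \<open>s\<close> is the limit of the sequence continuing \<open>x\<close> with
  \<open>bdf_op = 0\<close>; this is the Cauchy--Schwarz step.\<close>

lemma lambda_max_lower:
  assumes "\<And>m. m < k \<Longrightarrow> x m = 0"
  shows "(1 - \<tau>) / 2 * (\<Sum>i<k. bdf_op k x (k - 1 + i))\<^sup>2 \<le> lambda_max G * (\<Sum>i<k. (x (k + i))\<^sup>2)"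
proof -
  define s where "s = (\<Sum>i<k. bdf_op k x (k - 1 + i))"
  have G: "G \<in> carrier_mat k k" "transpose_mat G = G"
    using pos unfolding pos_def_symmetric_def by blast+
  have "0 \<le> energy k G (k - 1 + k) (\<lambda>m. - s + 1 * x m)"
    unfolding energy_def by (rule pos_def_qform_nonneg[OF pos])
  also have "\<dots> = s\<^sup>2 * ((1 - \<tau>) / 2) - s * (2 * pairing (k - 1 + k) x) + energy k G (k - 1 + k) x"
    using energy_affine[of "k - 1 + k" "- s" 1 x] energy_const[of "k - 1 + k" 1] by simp
  also have "2 * pairing (k - 1 + k) x = (1 - \<tau>) * s"
    unfolding s_def by (rule pairing_window[OF assms])
  finally have "(1 - \<tau>) / 2 * s\<^sup>2 \<le> energy k G (k - 1 + k) x"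
    by (simp add: power2_eq_square field_simps)
  also have "\<dots> \<le> lambda_max G * (\<Sum>i<k. (x (k - 1 + k + 1 + i - k))\<^sup>2)"
    unfolding energy_def by (rule rayleigh_bounds(1)[OF G order(1)])
  also have "\<dots> = lambda_max G * (\<Sum>i<k. (x (k + i))\<^sup>2)"
    using order by simp
  finally show ?thesis unfolding s_def .
qed

end

section \<open>Starting steps\<close>

text \<open>The test functions of the starting steps are rounded solutions of a semidefinite feasibility
  problem. The form in \<open>start_energy\<close> is affine in \<open>\<tau>\<close>, so it suffices to give square decompositions
  at both ends of an interval containing the admissible \<open>\<tau>\<close>.\<close>

lemma bdf3_start_energy:
  fixes x0 x1 x2 \<tau> :: real
  assumes "0 \<le> \<tau>" "\<tau> \<le> 1/10"
  shows "(1 - \<tau>) / 2 * x0\<^sup>2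
      + (11/6 * x1 - 11/6 * x0) * (x1 - \<tau> * x0)
      + (11/6 * x2 - 3 * x1 + 7/6 * x0) * (x2 - \<tau> * x1)
    \<le> 2 * x0\<^sup>2
      + (x1 - x0) * (9/4 * x1)
      + (3/2 * x2 - 2 * x1 + 1/2 * x0) * (3/2 * x2)"
proof -
  define f where "f t = 2 * x0\<^sup>2
      + (x1 - x0) * (9/4 * x1)
      + (3/2 * x2 - 2 * x1 + 1/2 * x0) * (3/2 * x2)
      - ((1 - t) / 2 * x0\<^sup>2
      + (11/6 * x1 - 11/6 * x0) * (x1 - t * x0)
      + (11/6 * x2 - 3 * x1 + 7/6 * x0) * (x2 - t * x1))" for t
  have "f 0 = 5/12 * (x1 - x0 + 1/2 * x0)\<^sup>2
        + 5/12 * (x2 - x0 + 1/2 * x0)\<^sup>2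
        + 31/24 * x0\<^sup>2"
    unfolding f_def by (simp add: power2_eq_square algebra_simps add_divide_distrib diff_divide_distrib)
  then have lo: "0 \<le> f 0" by simp
  have "f (1/10) = 7/60 * (x1 - x0 + 9/7 * x0 + 11/14 * (x2 - x0))\<^sup>2
        + 19/14 * (x0 + 51/380 * (x2 - x0))\<^sup>2
        + 4867/15200 * (x2 - x0)\<^sup>2"
    unfolding f_def by (simp add: power2_eq_square algebra_simps add_divide_distrib diff_divide_distrib)
  then have hi: "0 \<le> f (1/10)" by simp
  have "1/10 * f \<tau> = (1/10 - \<tau>) * f 0 + \<tau> * f (1/10)"
    unfolding f_def by (simp add: power2_eq_square algebra_simps add_divide_distrib diff_divide_distrib)
  moreover have "0 \<le> (1/10 - \<tau>) * f 0 + \<tau> * f (1/10)"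
    using lo hi assms by (intro add_nonneg_nonneg mult_nonneg_nonneg) simp_all
  ultimately have "0 \<le> f \<tau>" by linarith
  then show ?thesis unfolding f_def by linarith
qed

text \<open>The test combinations of the energy estimate must also control the reaction term. The
  left side is the defect that the telescoped Young inequality of the main steps leaves at the last
  starting value. As \<tau> occurs only there, its upper bound and a single square decomposition
  suffice.\<close>

lemma bdf3_start_dissipation:
  fixes x0 x1 x2 \<tau> :: real
  assumes "0 \<le> \<tau>" "\<tau> \<le> 1/10"
  shows "\<tau>\<^sup>2 / 2 * x2\<^sup>2 \<le> x0\<^sup>2
      + (x1 - x0) * (9/4 * x1)
      + (x2 - x0) * (3/2 * x2)"
proof -
  have "\<tau>\<^sup>2 \<le> (1/10)\<^sup>2" using assms by (intro power_mono)
  then have "\<tau>\<^sup>2 / 2 * x2\<^sup>2 \<le> 1/200 * x2\<^sup>2"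
    by (intro mult_right_mono) (simp_all add: power2_eq_square)
  also have "\<dots> \<le> 1/200 * x2\<^sup>2
        + 9/4 * (x1 - x0 + 1/2 * x0)\<^sup>2
        + 173/400 * (x0 + 298/173 * (x2 - x0))\<^sup>2
        + 293/1384 * (x2 - x0)\<^sup>2" by simp
  also have "\<dots> = x0\<^sup>2
      + (x1 - x0) * (9/4 * x1)
      + (x2 - x0) * (3/2 * x2)"
    by (simp add: power2_eq_square algebra_simps
        add_divide_distrib diff_divide_distrib)
  finally show ?thesis .
qed

text \<open>The left side is the bound of \<open>initial_energy_le\<close>, written out on the
  sequence prolonged by \<open>x0\<close>. For this order alone the test combinations contain the
  older value: \<open>2 * x2 - x1\<close> and \<open>2 * x3 - x2\<close>.\<close>

lemma bdf4_start_energy: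
  fixes x0 x1 x2 x3 \<tau> :: real
  assumes "1/4 \<le> \<tau>" "\<tau> \<le> 1/3"
  shows "(1 - \<tau>) / 2 * x0\<^sup>2
      + (25/12 * x1 - 25/12 * x0) * (x1 - \<tau> * x0)
      + (25/12 * x2 - 4 * x1 + 23/12 * x0) * (x2 - \<tau> * x1)
      + (25/12 * x3 - 4 * x2 + 3 * x1 - 13/12 * x0) * (x3 - \<tau> * x2)
    \<le> 17/5 * x0\<^sup>2
      + (x1 - x0) * (3 * x1)
      + (3/2 * x2 - 2 * x1 + 1/2 * x0) * (2 * x2 - x1)
      + (11/6 * x3 - 3 * x2 + 3/2 * x1 - 1/3 * x0) * (2 * x3 - x2)"
proof -
  define f where "f t = 17/5 * x0\<^sup>2
      + (x1 - x0) * (3 * x1)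
      + (3/2 * x2 - 2 * x1 + 1/2 * x0) * (2 * x2 - x1)
      + (11/6 * x3 - 3 * x2 + 3/2 * x1 - 1/3 * x0) * (2 * x3 - x2)
      - ((1 - t) / 2 * x0\<^sup>2
      + (25/12 * x1 - 25/12 * x0) * (x1 - t * x0)
      + (25/12 * x2 - 4 * x1 + 23/12 * x0) * (x2 - t * x1)
      + (25/12 * x3 - 4 * x2 + 3 * x1 - 13/12 * x0) * (x3 - t * x2))" for t
  have "f (1/4) = 23/12 * (x1 - x0 + 81/184 * x0 - 83/184 * (x2 - x0))\<^sup>2
        + 19/12 * (x3 - x0 + 13/152 * x0 - 159/152 * (x2 - x0))\<^sup>2
        + 44421/55936 * (x2 - x0 + 9155/14807 * x0)\<^sup>2
        + 8309927/3553680 * x0\<^sup>2"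
    unfolding f_def by (simp add: power2_eq_square algebra_simps add_divide_distrib diff_divide_distrib)
  then have lo: "0 \<le> f (1/4)" by simp
  have "f (1/3) = 19/12 * (x1 - x0 + 32/57 * x0 - 47/114 * (x2 - x0))\<^sup>2
        + 19/12 * (x3 - x0 + 8/57 * x0 - 113/114 * (x2 - x0))\<^sup>2
        + 6506/2565 * (x0 + 610/3253 * (x2 - x0))\<^sup>2
        + 2978623/4450104 * (x2 - x0)\<^sup>2"
    unfolding f_def by (simp add: power2_eq_square algebra_simps add_divide_distrib diff_divide_distrib)
  then have hi: "0 \<le> f (1/3)" by simp
  have "1/12 * f \<tau> = (1/3 - \<tau>) * f (1/4) + (\<tau> - 1/4) * f (1/3)"
    unfolding f_def by (simp add: power2_eq_square algebra_simps add_divide_distrib diff_divide_distrib)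
  moreover have "0 \<le> (1/3 - \<tau>) * f (1/4) + (\<tau> - 1/4) * f (1/3)"
    using lo hi assms by (intro add_nonneg_nonneg mult_nonneg_nonneg) simp_all
  ultimately have "0 \<le> f \<tau>" by linarith
  then show ?thesis unfolding f_def by linarith
qed

lemma bdf4_start_dissipation:
  fixes x0 x1 x2 x3 \<tau> :: real
  assumes "0 \<le> \<tau>" "\<tau> \<le> 1/3"
  shows "\<tau>\<^sup>2 / 2 * x3\<^sup>2 \<le> 8/5 * x0\<^sup>2
      + (x1 - x0) * (3 * x1)
      + (x2 - x0) * (2 * x2 - x1)
      + (x3 - x0) * (2 * x3 - x2)"
proof -
  have "\<tau>\<^sup>2 \<le> (1/3)\<^sup>2" using assms by (intro power_mono)
  then have "\<tau>\<^sup>2 / 2 * x3\<^sup>2 \<le> 1/18 * x3\<^sup>2"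
    by (intro mult_right_mono) (simp_all add: power2_eq_square)
  also have "\<dots> \<le> 1/18 * x3\<^sup>2
        + 3 * (x1 - x0 + 1/2 * x0 - 1/6 * (x2 - x0))\<^sup>2
        + 35/18 * (x3 - x0 + 8/35 * x0 - 9/35 * (x2 - x0))\<^sup>2
        + 97/140 * (x0 + 121/97 * (x2 - x0))\<^sup>2
        + 1033/1455 * (x2 - x0)\<^sup>2" by simp
  also have "\<dots> = 8/5 * x0\<^sup>2
      + (x1 - x0) * (3 * x1)
      + (x2 - x0) * (2 * x2 - x1)
      + (x3 - x0) * (2 * x3 - x2)"
    by (simp add: power2_eq_square algebra_simps
        add_divide_distrib diff_divide_distrib)
  finally show ?thesis .
qed

lemma bdf5_start_energy:
  fixes x0 x1 x2 x3 x4 \<tau> :: real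
  assumes "4/5 \<le> \<tau>" "\<tau> \<le> 5/6"
  shows "(1 - \<tau>) / 2 * x0\<^sup>2
      + (137/60 * x1 - 137/60 * x0) * (x1 - \<tau> * x0)
      + (137/60 * x2 - 5 * x1 + 163/60 * x0) * (x2 - \<tau> * x1)
      + (137/60 * x3 - 5 * x2 + 5 * x1 - 137/60 * x0) * (x3 - \<tau> * x2)
      + (137/60 * x4 - 5 * x3 + 5 * x2 - 10/3 * x1 + 21/20 * x0) * (x4 - \<tau> * x3)
    \<le> 5 * x0\<^sup>2
      + (x1 - x0) * (8 * x1)
      + (3/2 * x2 - 2 * x1 + 1/2 * x0) * (6 * x2)
      + (11/6 * x3 - 3 * x2 + 3/2 * x1 - 1/3 * x0) * (5 * x3)
      + (25/12 * x4 - 4 * x3 + 3 * x2 - 4/3 * x1 + 1/4 * x0) * (2 * x4)"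
proof -
  define f where "f t = 5 * x0\<^sup>2
      + (x1 - x0) * (8 * x1)
      + (3/2 * x2 - 2 * x1 + 1/2 * x0) * (6 * x2)
      + (11/6 * x3 - 3 * x2 + 3/2 * x1 - 1/3 * x0) * (5 * x3)
      + (25/12 * x4 - 4 * x3 + 3 * x2 - 4/3 * x1 + 1/4 * x0) * (2 * x4)
      - ((1 - t) / 2 * x0\<^sup>2
      + (137/60 * x1 - 137/60 * x0) * (x1 - t * x0)
      + (137/60 * x2 - 5 * x1 + 163/60 * x0) * (x2 - t * x1)
      + (137/60 * x3 - 5 * x2 + 5 * x1 - 137/60 * x0) * (x3 - t * x2)
      + (137/60 * x4 - 5 * x3 + 5 * x2 - 10/3 * x1 + 21/20 * x0) * (x4 - t * x3))" for t
  have "f (4/5) = 113/60 * (x4 - x0 + 1113/1130 * x0 + 20/113 * (x1 - x0) + 30/113 * (x2 - x0) - 176/565 * (x3 - x0))\<^sup>2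
        + 11239/6780 * (x1 - x0 + 13109/112390 * x0 - 22888/56195 * (x2 - x0) + 139/11239 * (x3 - x0))\<^sup>2
        + 25712207/8429250 * (x0 - 21648381/102848828 * (x2 - x0) + 112688/240301 * (x3 - x0))\<^sup>2
        + 121924409/60075250 * (x3 - x0 - 97410379/121924409 * (x2 - x0))\<^sup>2
        + 27500551396673/31310188231200 * (x2 - x0)\<^sup>2"
    unfolding f_def by (simp add: power2_eq_square algebra_simps add_divide_distrib diff_divide_distrib)
  then have lo: "0 \<le> f (4/5)" by simp
  have "f (5/6) = 51/20 * (x2 - x0 - 137/1836 * x0 - 335/1836 * (x1 - x0) - 1415/1836 * (x3 - x0) + 10/51 * (x4 - x0))\<^sup>2
        + 607/340 * (x4 - x0 + 70883/65556 * x0 + 7795/32778 * (x1 - x0) - 5995/65556 * (x3 - x0))\<^sup>2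
        + 84047429/70800480 * (x3 - x0 + 59444417/84047429 * x0 - 64945475/168094858 * (x1 - x0))\<^sup>2
        + 8401690742/3782134305 * (x0 + 40517344109/268854103744 * (x1 - x0))\<^sup>2
        + 1319965090575857/1161449728174080 * (x1 - x0)\<^sup>2"
    unfolding f_def by (simp add: power2_eq_square algebra_simps add_divide_distrib diff_divide_distrib)
  then have hi: "0 \<le> f (5/6)" by simp
  have "1/30 * f \<tau> = (5/6 - \<tau>) * f (4/5) + (\<tau> - 4/5) * f (5/6)"
    unfolding f_def by (simp add: power2_eq_square algebra_simps add_divide_distrib diff_divide_distrib)
  moreover have "0 \<le> (5/6 - \<tau>) * f (4/5) + (\<tau> - 4/5) * f (5/6)"
    using lo hi assms by (intro add_nonneg_nonneg mult_nonneg_nonneg) simp_all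
  ultimately have "0 \<le> f \<tau>" by linarith
  then show ?thesis unfolding f_def by linarith
qed

lemma bdf5_start_dissipation:
  fixes x0 x1 x2 x3 x4 \<tau> :: real
  assumes "0 \<le> \<tau>" "\<tau> \<le> 5/6"
  shows "\<tau>\<^sup>2 / 2 * x4\<^sup>2 \<le> 6 * x0\<^sup>2
      + (x1 - x0) * (8 * x1)
      + (x2 - x0) * (6 * x2)
      + (x3 - x0) * (5 * x3)
      + (x4 - x0) * (2 * x4)"
proof -
  have "\<tau>\<^sup>2 \<le> (5/6)\<^sup>2" using assms by (intro power_mono)
  then have "\<tau>\<^sup>2 / 2 * x4\<^sup>2 \<le> 25/72 * x4\<^sup>2"
    by (intro mult_right_mono) (simp_all add: power2_eq_square)
  also have "\<dots> \<le> 25/72 * x4\<^sup>2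
        + 8 * (x1 - x0 + 1/2 * x0)\<^sup>2
        + 6 * (x2 - x0 + 1/2 * x0)\<^sup>2
        + 5 * (x3 - x0 + 1/2 * x0)\<^sup>2
        + 65/72 * (x0 + 47/65 * (x4 - x0))\<^sup>2
        + 307/260 * (x4 - x0)\<^sup>2" by simp
  also have "\<dots> = 6 * x0\<^sup>2
      + (x1 - x0) * (8 * x1)
      + (x2 - x0) * (6 * x2)
      + (x3 - x0) * (5 * x3)
      + (x4 - x0) * (2 * x4)"
    by (simp add: power2_eq_square algebra_simps
        add_divide_distrib diff_divide_distrib)
  finally show ?thesis .
qed

lemma sum_lessThan_2: "(\<Sum>i<2. f i) = f 0 + f 1"
  and sum_lessThan_3: "(\<Sum>i<3. f i) = f 0 + f 1 + f 2"
  and sum_lessThan_4: "(\<Sum>i<4. f i) = f 0 + f 1 + f 2 + f 3"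
  for f :: "nat \<Rightarrow> real"
  by (simp_all add: lessThan_nat_numeral)

lemmas sum_lessThans = sum_lessThan_2 sum_lessThan_3 sum_lessThan_4

text \<open>Each decimal with its rounding tolerance lies inside the interval on which the starting
  estimates hold. For orders 4 and 5 the lower end matters as well, since it enlarges the admissible
  \<open>k / (1 - \<tau>\<^sup>2)\<close>.\<close>

lemma is_bdf_tau_bounds:
  "is_bdf_tau (Suc 0) \<tau> \<Longrightarrow> \<tau> = 0" "is_bdf_tau 2 \<tau> \<Longrightarrow> \<tau> = 0"
  "is_bdf_tau 3 \<tau> \<Longrightarrow> 0 \<le> \<tau> \<and> \<tau> \<le> 1/10"
  "is_bdf_tau 4 \<tau> \<Longrightarrow> 1/4 \<le> \<tau> \<and> \<tau> \<le> 1/3"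
  "is_bdf_tau 5 \<tau> \<Longrightarrow> 4/5 \<le> \<tau> \<and> \<tau> \<le> 5/6"
  unfolding is_bdf_tau_def bdf_tau_decimal_def abs_le_iff by auto

section \<open>Constants for the starting values\<close>

context bdf_multiplier
begin

text \<open>The entries of \<open>vs\<close> are the values following \<open>k\<close> zeros, so
  that concrete vectors yield numerical lower bounds for \<open>lambda_max G\<close>.\<close>

lemma lambda_max_lower_list:
  "(1 - \<tau>) / 2 * (\<Sum>i<k. bdf_op k (\<lambda>m. if m < k then 0 else vs ! (m - k)) (k - 1 + i))\<^sup>2
    \<le> lambda_max G * (\<Sum>i<k. (vs ! i)\<^sup>2)"
  using lambda_max_lower[of "\<lambda>m. if m < k then 0 else vs ! (m - k)"] by simp

text \<open>The sequence is prolonged to the left by its initial value, where \<open>bdf_op\<close> vanishes.\<close>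

lemma initial_energy_le:
  "energy k G (k - 1) x \<le> (1 - \<tau>) / 2 * (x 0)\<^sup>2
    + (\<Sum>i<k-1. bdf_op k (\<lambda>m. x (m + 1 - k)) (k - 1 + i) * (x (i + 1) - \<tau> * x i))"
proof -
  let ?u = "\<lambda>m. x (m + 1 - k)"
  have "energy k G (k - 1) x = energy k G (k - 1 + (k - 1)) ?u"
    using order by (intro energy_cong) (auto intro!: arg_cong[of _ _ x])
  also have "\<dots> \<le> energy k G (k - 1) ?u
      + (\<Sum>i<k-1. bdf_op k ?u (k - 1 + i) * (?u (k - 1 + i + 1) - \<tau> * ?u (k - 1 + i)))"
    by (rule energy_le_telescoped) simp
  also have "energy k G (k - 1) ?u = energy k G (k - 1) (\<lambda>_. x 0)"
    using order by (intro energy_cong) (auto intro!: arg_cong[of _ _ x])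
  also have "\<dots> = (1 - \<tau>) / 2 * (x 0)\<^sup>2" by (rule energy_const)
  finally show ?thesis using order by simp
qed

text \<open>Makes the five orders uniform for the final proof. \<open>c0\<close> accompanies the
  weight 1 - \<theta> and \<open>c1\<close> the weight \<theta>; the inequality for
  \<open>c1\<close> charges the start to \<open>k\<close> time steps. The condition
  \<open>q 0 = 0\<close> keeps the initial memory value out of the test terms.\<close>

lemma starting_multipliers:
  assumes "is_bdf_tau k \<tau>"
  obtains p q :: "nat \<Rightarrow> real" and c0 c1 :: real
  where "\<tau>\<^sup>2 < 1" "k = 1 \<Longrightarrow> \<tau> = 0" "q 0 = 0" "c0 * (1 - \<tau>\<^sup>2) \<le> lambda_max G"
    "2 * c1 + 1 \<le> k / (1 - \<tau>\<^sup>2)"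
    "\<And>x. energy k G (k - 1) x
      \<le> c0 * (x 0)\<^sup>2 + (\<Sum>i<k-1. bdf_op (i + 1) x i * (p i * x (i + 1) + q i * x i))"
    "\<And>x. \<tau>\<^sup>2 / 2 * (x (k - 1))\<^sup>2
      \<le> c1 * (x 0)\<^sup>2 + (\<Sum>i<k-1. (x (i + 1) - x 0) * (p i * x (i + 1) + q i * x i))"
  using order
proof (cases rule: bdf_order_cases)
  case 1
  then have \<tau>: "\<tau> = 0" using assms is_bdf_tau_bounds(1) by simp
  have lam: "1 / 2 * (1 - \<tau>\<^sup>2) \<le> lambda_max G"
    using lambda_max_lower_list[of "[1]"] 1 \<tau> by (simp add: bdf_ops)
  show ?thesis
    by (rule that[of "\<lambda>_. 0" "1/2" 0 "\<lambda>_. 0"])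
      (use lam initial_energy_le 1 \<tau> in auto)
next
  case 2
  then have \<tau>: "\<tau> = 0" using assms is_bdf_tau_bounds(2) by simp
  have lam: "1 / 2 * (1 - \<tau>\<^sup>2) \<le> lambda_max G"
    using lambda_max_lower_list[of "[0, 1]"] 2 \<tau>
    by (simp add: bdf_ops lessThan_nat_numeral power2_eq_square)
  \<comment> \<open>On the prolonged sequence the order-2 operator is 3/2 times the order-1
    operator, whence the multiplier 3/2.\<close>
  have energy: "energy k G (k - 1) x \<le> 1 / 2 * (x 0)\<^sup>2
      + (\<Sum>i<k-1. bdf_op (i + 1) x i * (3/2 * x (i + 1) + 0 * x i))" for x
    using initial_energy_le[of x] 2 \<tau>
    by (simp add: bdf_ops algebra_simps add_divide_distrib diff_divide_distrib)
  have dissipation: "\<tau>\<^sup>2 / 2 * (x (k - 1))\<^sup>2 \<le> 1 / 2 * (x 0)\<^sup>2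
      + (\<Sum>i<k-1. (x (i + 1) - x 0) * (3/2 * x (i + 1) + 0 * x i))" for x
  proof -
    have "0 \<le> 3/2 * (x 1 - 1/2 * x 0)\<^sup>2 + 1/8 * (x 0)\<^sup>2" by simp
    then show ?thesis
      using 2 \<tau> by (simp add: power2_eq_square algebra_simps add_divide_distrib diff_divide_distrib)
  qed
  show ?thesis
    by (rule that[of "\<lambda>_. 0" "1/2" "1/2" "\<lambda>_. 3/2"])
      (use lam energy dissipation 2 \<tau> in auto)
next
  case 3
  then have \<tau>: "0 \<le> \<tau>" "\<tau> \<le> 1/10"
    using assms is_bdf_tau_bounds(3) by auto
  have sq: "0 \<le> \<tau>\<^sup>2" "\<tau>\<^sup>2 \<le> 1/100"
    using power_mono[OF \<tau>(1), of 2] power_mono[OF \<tau>(2), of 2] \<tau> by (simp_all add: power2_eq_square)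
  \<comment> \<open>Optimal for Cauchy--Schwarz would be the coefficients (1/3, -7/6, 11/6) of the
    summed operator; \<open>[0, -1, 2]\<close> is a nearby integer vector with sum 29/6 and squared
    norm 5.\<close>
  have "(1 - \<tau>) / 2 * (29/6)\<^sup>2 \<le> lambda_max G * 5"
    using lambda_max_lower_list[of "[0, -1, 2]"] 3
    by (simp add: bdf_ops lessThan_nat_numeral)
  \<comment> \<open>The factor 1 - \<tau> of the lower bound is also a factor of
    \<open>1 - \<tau>\<^sup>2\<close>; what remains to compare is numerical.\<close>
  moreover have "(1 - \<tau>) * (2 * (1 + \<tau>)) \<le> (1 - \<tau>) * ((29/6)\<^sup>2 / 10)"
    using \<tau> by (intro mult_left_mono) (simp_all add: power2_eq_square)
  ultimately have lam: "2 * (1 - \<tau>\<^sup>2) \<le> lambda_max G"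
    by (simp add: power2_eq_square algebra_simps add_divide_distrib diff_divide_distrib)
  have energy: "energy k G (k - 1) x \<le> 2 * (x 0)\<^sup>2
      + (\<Sum>i<k-1. bdf_op (i + 1) x i * ([9/4, 3/2] ! i * x (i + 1) + [0, 0] ! i * x i))" for x
  proof -
    \<comment> \<open>Truncated subtraction realizes the prolongation: \<open>?u\<close> equals
      \<open>x 0\<close> up to index 2.\<close>
    let ?u = "\<lambda>m. x (m - 2)"
    have u: "bdf_op 3 ?u 2 = 11/6 * x 1 - 11/6 * x 0"
      "bdf_op 3 ?u 3 = 11/6 * x 2 - 3 * x 1 + 7/6 * x 0"
      by (simp_all add: bdf_ops)
    have s: "bdf_op 1 x 0 = x 1 - x 0"
      "bdf_op 2 x 1 = 3/2 * x 2 - 2 * x 1 + 1/2 * x 0"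
      by (simp_all add: bdf_ops bdf_op_1[folded One_nat_def] One_nat_def[symmetric]
          del: One_nat_def)
    show ?thesis
      using initial_energy_le[of x] bdf3_start_energy[OF \<tau>, of "x 0" "x 1" "x 2"] 3
      by (simp add: sum_lessThans u s numeral_2_eq_2[symmetric] del: One_nat_def)
  qed
  have dissipation: "\<tau>\<^sup>2 / 2 * (x (k - 1))\<^sup>2 \<le> 1 * (x 0)\<^sup>2
      + (\<Sum>i<k-1. (x (i + 1) - x 0) * ([9/4, 3/2] ! i * x (i + 1) + [0, 0] ! i * x i))" for x
    using bdf3_start_dissipation[of \<tau> "x 2" "x 0" "x 1"] 3 \<tau>
    by (simp add: sum_lessThans del: One_nat_def)
  show ?thesis
    by (rule that[of "(!) [0, 0]" "2" "1" "(!) [9/4, 3/2]"])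
      (use lam energy dissipation 3 sq in \<open>auto simp: field_simps\<close>)
next
  case 4
  then have \<tau>: "1/4 \<le> \<tau>" "\<tau> \<le> 1/3"
    using assms is_bdf_tau_bounds(4) by auto
  have sq: "1/16 \<le> \<tau>\<^sup>2" "\<tau>\<^sup>2 \<le> 1/9"
    using power_mono[OF \<tau>(1), of 2] power_mono[OF \<tau>(2), of 2] \<tau> by (simp_all add: power2_eq_square)
  \<comment> \<open>The vector rounds the coefficients (-1/4, 13/12, -23/12, 25/12) of the summed
    operator.\<close>
  have "(1 - \<tau>) / 2 * (109/12)\<^sup>2 \<le> lambda_max G * 9"
    using lambda_max_lower_list[of "[0, 1, -2, 2]"] 4
    by (simp add: bdf_ops lessThan_nat_numeral)
  moreover have "(1 - \<tau>) * (17/5 * (1 + \<tau>)) \<le> (1 - \<tau>) * ((109/12)\<^sup>2 / 18)"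
    using \<tau> by (intro mult_left_mono) (simp_all add: power2_eq_square)
  ultimately have lam: "17/5 * (1 - \<tau>\<^sup>2) \<le> lambda_max G"
    by (simp add: power2_eq_square algebra_simps add_divide_distrib diff_divide_distrib)
  have energy: "energy k G (k - 1) x \<le> 17/5 * (x 0)\<^sup>2
      + (\<Sum>i<k-1. bdf_op (i + 1) x i * ([3, 2, 2] ! i * x (i + 1) + [0, -1, -1] ! i * x i))" for x
  proof -
    let ?u = "\<lambda>m. x (m - 3)"
    have u: "bdf_op 4 ?u 3 = 25/12 * x 1 - 25/12 * x 0"
      "bdf_op 4 ?u 4 = 25/12 * x 2 - 4 * x 1 + 23/12 * x 0"
      "bdf_op 4 ?u 5 = 25/12 * x 3 - 4 * x 2 + 3 * x 1 - 13/12 * x 0"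
      by (simp_all add: bdf_ops)
    have s: "bdf_op 1 x 0 = x 1 - x 0"
      "bdf_op 2 x 1 = 3/2 * x 2 - 2 * x 1 + 1/2 * x 0"
      "bdf_op 3 x 2 = 11/6 * x 3 - 3 * x 2 + 3/2 * x 1 - 1/3 * x 0"
      by (simp_all add: bdf_ops bdf_op_1[folded One_nat_def] One_nat_def[symmetric]
          del: One_nat_def)
    show ?thesis
      using initial_energy_le[of x] bdf4_start_energy[OF \<tau>, of "x 0" "x 1" "x 2" "x 3"] 4
      by (simp add: sum_lessThans u s numeral_2_eq_2[symmetric] del: One_nat_def)
  qed
  have dissipation: "\<tau>\<^sup>2 / 2 * (x (k - 1))\<^sup>2 \<le> 8/5 * (x 0)\<^sup>2
      + (\<Sum>i<k-1. (x (i + 1) - x 0) * ([3, 2, 2] ! i * x (i + 1) + [0, -1, -1] ! i * x i))" for x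
    using bdf4_start_dissipation[of \<tau> "x 3" "x 0" "x 1" "x 2"] 4 \<tau>
    by (simp add: sum_lessThans del: One_nat_def)
  show ?thesis
    by (rule that[of "(!) [0, -1, -1]" "17/5" "8/5" "(!) [3, 2, 2]"])
      (use lam energy dissipation 4 sq in \<open>auto simp: field_simps\<close>)
next
  case 5
  then have \<tau>: "4/5 \<le> \<tau>" "\<tau> \<le> 5/6"
    using assms is_bdf_tau_bounds(5) by auto
  have sq: "16/25 \<le> \<tau>\<^sup>2" "\<tau>\<^sup>2 \<le> 25/36"
    using power_mono[OF \<tau>(1), of 2] power_mono[OF \<tau>(2), of 2] \<tau> by (simp_all add: power2_eq_square)
  \<comment> \<open>The vector rounds the coefficients (1/5, -21/20, 137/60, -163/60,
    137/60).\<close>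
  have "(1 - \<tau>) / 2 * (937/60)\<^sup>2 \<le> lambda_max G * 13"
    using lambda_max_lower_list[of "[0, -1, 2, -2, 2]"] 5
    by (simp add: bdf_ops lessThan_nat_numeral)
  moreover have "(1 - \<tau>) * (5 * (1 + \<tau>)) \<le> (1 - \<tau>) * ((937/60)\<^sup>2 / 26)"
    using \<tau> by (intro mult_left_mono) (simp_all add: power2_eq_square)
  ultimately have lam: "5 * (1 - \<tau>\<^sup>2) \<le> lambda_max G"
    by (simp add: power2_eq_square algebra_simps add_divide_distrib diff_divide_distrib)
  have energy: "energy k G (k - 1) x \<le> 5 * (x 0)\<^sup>2
      + (\<Sum>i<k-1. bdf_op (i + 1) x i * ([8, 6, 5, 2] ! i * x (i + 1) + [0, 0, 0, 0] ! i * x i))" for x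
  proof -
    let ?u = "\<lambda>m. x (m - 4)"
    have u: "bdf_op 5 ?u 4 = 137/60 * x 1 - 137/60 * x 0"
      "bdf_op 5 ?u 5 = 137/60 * x 2 - 5 * x 1 + 163/60 * x 0"
      "bdf_op 5 ?u 6 = 137/60 * x 3 - 5 * x 2 + 5 * x 1 - 137/60 * x 0"
      "bdf_op 5 ?u 7 = 137/60 * x 4 - 5 * x 3 + 5 * x 2 - 10/3 * x 1 + 21/20 * x 0"
      by (simp_all add: bdf_ops)
    have s: "bdf_op 1 x 0 = x 1 - x 0"
      "bdf_op 2 x 1 = 3/2 * x 2 - 2 * x 1 + 1/2 * x 0"
      "bdf_op 3 x 2 = 11/6 * x 3 - 3 * x 2 + 3/2 * x 1 - 1/3 * x 0"
      "bdf_op 4 x 3 = 25/12 * x 4 - 4 * x 3 + 3 * x 2 - 4/3 * x 1 + 1/4 * x 0"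
      by (simp_all add: bdf_ops bdf_op_1[folded One_nat_def] One_nat_def[symmetric]
          del: One_nat_def)
    show ?thesis
      using initial_energy_le[of x] bdf5_start_energy[OF \<tau>, of "x 0" "x 1" "x 2" "x 3" "x 4"] 5
      by (simp add: sum_lessThans u s numeral_2_eq_2[symmetric] del: One_nat_def)
  qed
  have dissipation: "\<tau>\<^sup>2 / 2 * (x (k - 1))\<^sup>2 \<le> 6 * (x 0)\<^sup>2
      + (\<Sum>i<k-1. (x (i + 1) - x 0) * ([8, 6, 5, 2] ! i * x (i + 1) + [0, 0, 0, 0] ! i * x i))" for x
    using bdf5_start_dissipation[of \<tau> "x 4" "x 0" "x 1" "x 2" "x 3"] 5 \<tau>
    by (simp add: sum_lessThans del: One_nat_def)
  show ?thesis
    by (rule that[of "(!) [0, 0, 0, 0]" "5" "6" "(!) [8, 6, 5, 2]"])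
      (use lam energy dissipation 5 sq in \<open>auto simp: field_simps\<close>)
qed

end

section \<open>The weighted integral\<close>

text \<open>A class that contains all iterates of the scheme (see \<open>bdf_step_tame\<close>), is
  closed under sums and products, and is integrable against the singular weight.\<close>

definition tame :: "(real \<Rightarrow> real) \<Rightarrow> bool" where
  "tame f \<longleftrightarrow> continuous_on {0<..<1} f \<and> (\<exists>B. \<forall>\<theta>\<in>{0<..<1}. \<bar>f \<theta>\<bar> \<le> B)"

lemma tame_const: "tame (\<lambda>_. c)"
  by (auto simp: tame_def)

lemma tame_ident: "tame (\<lambda>\<theta>. \<theta>)"
  by (auto simp: tame_def intro!: exI[of _ 1])

lemma tame_add:
  assumes "tame f" "tame g"
  shows "tame (\<lambda>\<theta>. f \<theta> + g \<theta>)"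
proof -
  from assms obtain B C where "\<forall>\<theta>\<in>{0<..<1}. \<bar>f \<theta>\<bar> \<le> B" "\<forall>\<theta>\<in>{0<..<1}. \<bar>g \<theta>\<bar> \<le> C"
    unfolding tame_def by blast
  then have "\<forall>\<theta>\<in>{0<..<1}. \<bar>f \<theta> + g \<theta>\<bar> \<le> B + C" by (meson abs_triangle_ineq add_mono order_trans)
  then show ?thesis using assms unfolding tame_def by (blast intro: continuous_on_add)
qed

lemma tame_mult:
  assumes "tame f" "tame g"
  shows "tame (\<lambda>\<theta>. f \<theta> * g \<theta>)"
proof -
  from assms obtain B C where "\<forall>\<theta>\<in>{0<..<1}. \<bar>f \<theta>\<bar> \<le> B" "\<forall>\<theta>\<in>{0<..<1}. \<bar>g \<theta>\<bar> \<le> C"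
    unfolding tame_def by blast
  then have "\<forall>\<theta>\<in>{0<..<1}. \<bar>f \<theta> * g \<theta>\<bar> \<le> B * C"
    unfolding abs_mult by (meson abs_ge_zero mult_mono order_trans)
  then show ?thesis using assms unfolding tame_def by (blast intro: continuous_on_mult)
qed

lemma tame_diff: "tame f \<Longrightarrow> tame g \<Longrightarrow> tame (\<lambda>\<theta>. f \<theta> - g \<theta>)"
  using tame_add[of f "\<lambda>\<theta>. - 1 * g \<theta>"] tame_mult[OF tame_const[of "- 1"], of g] by simp

lemma tame_sum: "(\<And>i. i \<in> I \<Longrightarrow> tame (f i)) \<Longrightarrow> tame (\<lambda>\<theta>. \<Sum>i\<in>I. f i \<theta>)"
  by (induction I rule: infinite_finite_induct) (auto intro: tame_add tame_const)

lemma tame_power2: "tame f \<Longrightarrow> tame (\<lambda>\<theta>. (f \<theta>)\<^sup>2)"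
  unfolding power2_eq_square by (intro tame_mult)

lemmas tame_intros = tame_const tame_ident tame_add tame_mult tame_diff tame_sum tame_power2

lemma tame_cong:
  assumes "tame g" "\<And>\<theta>. \<theta> \<in> {0<..<1} \<Longrightarrow> f \<theta> = g \<theta>"
  shows "tame f"
proof -
  have "continuous_on {0<..<1} f \<longleftrightarrow> continuous_on {0<..<1} g"
    using assms(2) by (intro continuous_on_cong) auto
  then show ?thesis using assms unfolding tame_def by auto
qed

lemma tame_divide:
  assumes "tame f" "tame g" "c > 0" "\<And>\<theta>. \<theta> \<in> {0<..<1} \<Longrightarrow> c \<le> g \<theta>"
  shows "tame (\<lambda>\<theta>. f \<theta> / g \<theta>)"
proof -
  have pos: "0 < g \<theta>" if "\<theta> \<in> {0<..<1}" for \<theta>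
    using assms(3) assms(4)[OF that] by linarith
  have "continuous_on {0<..<1} (\<lambda>\<theta>. inverse (g \<theta>))"
    using assms(2) pos unfolding tame_def by (intro continuous_on_inverse) force+
  moreover have "\<bar>inverse (g \<theta>)\<bar> \<le> inverse c" if "\<theta> \<in> {0<..<1}" for \<theta>
    using pos[OF that] assms(3) assms(4)[OF that] by (simp add: le_imp_inverse_le)
  ultimately have "tame (\<lambda>\<theta>. inverse (g \<theta>))" unfolding tame_def by blast
  then show ?thesis using tame_mult[OF assms(1)] by (simp add: divide_inverse)
qed

lemma Beta_set_integral:
  assumes "a > 0" "b > (0 :: real)"
  shows "set_integrable lborel {0<..<1} (\<lambda>t. t powr (a - 1) * (1 - t) powr (b - 1))"
    and "(LINT t:{0<..<1}|lborel. t powr (a - 1) * (1 - t) powr (b - 1)) = Beta a b"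
proof -
  show int: "set_integrable lborel {0<..<1} (\<lambda>t. t powr (a - 1) * (1 - t) powr (b - 1))"
    by (rule set_integrable_subset[OF integrable_Beta[OF assms]]) auto
  have "((\<lambda>t. t powr (a - 1) * (1 - t) powr (b - 1)) has_integral Beta a b) {0<..<1}"
    using has_integral_Beta_real[OF assms] by (simp add: has_integral_Icc_iff_Ioo)
  then show "(LINT t:{0<..<1}|lborel. t powr (a - 1) * (1 - t) powr (b - 1)) = Beta a b"
    using set_borel_integral_eq_integral(2)[OF int] by (simp add: integral_unique)
qed

section \<open>Integration against the weight and its moments\<close>

locale weight =
  fixes \<alpha> :: real
  assumes \<alpha>: "0 < \<alpha>" "\<alpha> < 1"
begin

lemma Gammas_pos: "Gamma (1 - \<alpha>) * Gamma \<alpha> > 0"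
  using \<alpha> by (intro mult_pos_pos Gamma_real_pos) auto

lemma Gammas_nonzero: "Gamma (1 - \<alpha>) \<noteq> 0" "Gamma \<alpha> \<noteq> 0"
  using Gammas_pos by auto

lemma omega_nonneg: "omega \<alpha> \<theta> \<ge> 0"
  using Gammas_pos by (simp add: omega_def)

lemma omega_eq: "omega \<alpha> \<theta> =
  (\<theta> powr ((1 - \<alpha>) - 1) * (1 - \<theta>) powr (\<alpha> - 1)) / (Gamma (1 - \<alpha>) * Gamma \<alpha>)"
  by (simp add: omega_def)

lemma omega_integrable: "set_integrable lborel {0<..<1} (omega \<alpha>)"
  using Beta_set_integral(1)[of "1 - \<alpha>" \<alpha>] \<alpha> unfolding omega_eq[abs_def] by simp

text \<open>A bound on the factor gives a multiple of the integrable weight as majorant; continuity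
  on the open interval gives measurability of the function cut off outside it.\<close>

lemma tame_integrable:
  assumes "tame f"
  shows "set_integrable lborel {0<..<1} (\<lambda>\<theta>. f \<theta> * omega \<alpha> \<theta>)"
proof -
  from assms obtain B where B: "\<And>\<theta>. \<theta> \<in> {0<..<1} \<Longrightarrow> \<bar>f \<theta>\<bar> \<le> B"
    unfolding tame_def by blast
  show ?thesis
  proof (rule set_integrable_bound)
    show "set_integrable lborel {0<..<1} (\<lambda>\<theta>. B * omega \<alpha> \<theta>)"
      using omega_integrable by simp
    have "set_borel_measurable borel {0<..<1} f"
      using assms borel_measurable_continuous_on_indicator[of "{0<..<1}" f]
      unfolding tame_def set_borel_measurable_def by auto
    moreover have "omega \<alpha> \<in> borel_measurable borel"
      unfolding omega_def[abs_def] by measurable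
    ultimately have "(\<lambda>\<theta>. (indicator {0<..<1} \<theta> *\<^sub>R f \<theta>) * omega \<alpha> \<theta>) \<in> borel_measurable borel"
      unfolding set_borel_measurable_def by (intro borel_measurable_times)
    then show "set_borel_measurable lborel {0<..<1} (\<lambda>\<theta>. f \<theta> * omega \<alpha> \<theta>)"
      unfolding set_borel_measurable_def by (simp add: mult.assoc)
    have "\<bar>f \<theta> * omega \<alpha> \<theta>\<bar> \<le> \<bar>B * omega \<alpha> \<theta>\<bar>" if "\<theta> \<in> {0<..<1}" for \<theta>
      using B[OF that] omega_nonneg[of \<theta>] by (simp add: abs_mult mult_right_mono)
    then show "AE \<theta> in lborel. \<theta> \<in> {0<..<1} \<longrightarrow> norm (f \<theta> * omega \<alpha> \<theta>) \<le> norm (B * omega \<alpha> \<theta>)"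
      by simp
  qed
qed

lemma C_op_add: "tame f \<Longrightarrow> tame g \<Longrightarrow> C_op \<alpha> (\<lambda>\<theta>. f \<theta> + g \<theta>) = C_op \<alpha> f + C_op \<alpha> g"
  unfolding C_op_def distrib_right by (intro set_integral_add tame_integrable)

lemma C_op_cmult: "C_op \<alpha> (\<lambda>\<theta>. c * f \<theta>) = c * C_op \<alpha> f"
  unfolding C_op_def mult.assoc by simp

lemma C_op_diff: "tame f \<Longrightarrow> tame g \<Longrightarrow> C_op \<alpha> (\<lambda>\<theta>. f \<theta> - g \<theta>) = C_op \<alpha> f - C_op \<alpha> g"
  unfolding C_op_def left_diff_distrib by (intro set_integral_diff tame_integrable)

lemma C_op_sum:
  assumes "\<And>i. i \<in> I \<Longrightarrow> tame (f i)"
  shows "C_op \<alpha> (\<lambda>\<theta>. \<Sum>i\<in>I. f i \<theta>) = (\<Sum>i\<in>I. C_op \<alpha> (f i))"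
  using assms
proof (induction I rule: infinite_finite_induct)
  case (insert i I)
  then show ?case using C_op_add[of "f i" "\<lambda>\<theta>. \<Sum>i\<in>I. f i \<theta>"] by (simp add: tame_sum)
qed (simp_all add: C_op_def)

lemma C_op_mono:
  assumes "tame f" "tame g" "\<And>\<theta>. \<theta> \<in> {0<..<1} \<Longrightarrow> f \<theta> \<le> g \<theta>"
  shows "C_op \<alpha> f \<le> C_op \<alpha> g"
  unfolding C_op_def using assms omega_nonneg
  by (intro set_integral_mono tame_integrable mult_right_mono)

text \<open>The Gamma factors are the right normalization because the arguments of the Beta function
  add up to 1.\<close>

lemma C_op_1: "C_op \<alpha> (\<lambda>_. 1) = 1"
proof -
  have "C_op \<alpha> (\<lambda>_. 1) = Beta (1 - \<alpha>) \<alpha> / (Gamma (1 - \<alpha>) * Gamma \<alpha>)"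
    using Beta_set_integral(2)[of "1 - \<alpha>" \<alpha>] \<alpha> unfolding C_op_def omega_eq[abs_def] by simp
  also have "\<dots> = 1" using Gammas_nonzero by (simp add: Beta_def)
  finally show ?thesis .
qed

text \<open>The extra factor shifts the first Beta argument by one, and the recurrence of the Beta
  function gives 1 - \<alpha>. This moment and its complement produce the two constants in the final
  bound.\<close>

lemma C_op_ident: "C_op \<alpha> (\<lambda>\<theta>. \<theta>) = 1 - \<alpha>"
proof -
  have powr: "\<theta> * \<theta> powr - \<alpha> = \<theta> powr (1 - \<alpha>)" if "0 < \<theta>" for \<theta> :: real
    using that powr_mult_base[of \<theta> "- \<alpha>"] by simp
  have "C_op \<alpha> (\<lambda>\<theta>. \<theta>) = (LINT \<theta>:{0<..<1}|lborel.
      \<theta> powr ((1 - \<alpha> + 1) - 1) * (1 - \<theta>) powr (\<alpha> - 1) / (Gamma (1 - \<alpha>) * Gamma \<alpha>))"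
    unfolding C_op_def omega_eq
    by (rule set_lebesgue_integral_cong) (simp_all add: powr[symmetric])
  also have "\<dots> = Beta (1 - \<alpha> + 1) \<alpha> / (Gamma (1 - \<alpha>) * Gamma \<alpha>)"
    using Beta_set_integral(2)[of "1 - \<alpha> + 1" \<alpha>] \<alpha> by simp
  also have "Beta (1 - \<alpha> + 1) \<alpha> = (1 - \<alpha>) * Beta (1 - \<alpha>) \<alpha>"
  proof -
    have "1 - \<alpha> \<notin> \<int>\<^sub>\<le>\<^sub>0" using \<alpha> nonpos_Ints_nonpos[of "1 - \<alpha>"] by auto
    then show ?thesis using Beta_plus1_left[of "1 - \<alpha>" \<alpha>] by simp
  qed
  also have "\<dots> / (Gamma (1 - \<alpha>) * Gamma \<alpha>) = 1 - \<alpha>"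
    using Gammas_nonzero by (simp add: Beta_def)
  finally show ?thesis .
qed

lemma weighted_norm_sq_omega0: "weighted_norm_sq (omega0 \<alpha>) v = C_op \<alpha> (\<lambda>\<theta>. (1 - \<theta>) * (v \<theta>)\<^sup>2)"
  and weighted_norm_sq_omega1: "weighted_norm_sq (omega1 \<alpha>) v = C_op \<alpha> (\<lambda>\<theta>. \<theta> * (v \<theta>)\<^sup>2)"
  by (simp_all add: weighted_norm_sq_def C_op_def omega0_def omega1_def mult_ac)

end

text \<open>Whatever its value, the memory term is a single number, so the step can be solved for
  \<open>\<phi> (n + 1) \<theta>\<close> before integrability is known. The denominator is a convex
  combination of \<open>c\<close> and 1, hence at least \<open>min c 1\<close>.\<close>

lemma bdf_step_tame:
  assumes step: "bdf_step \<alpha> lam \<Delta>t \<phi>0 k \<phi> n" and k: "1 \<le> k" "k \<le> 5" and "\<Delta>t > 0"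
    and tame: "\<And>j. j < k \<Longrightarrow> tame (\<phi> (n - j))"
  shows "tame (\<phi> (n + 1))"
proof -
  define c where "c = bdf_alpha k / \<Delta>t"
  have "bdf_alpha k > 0"
    using k by (cases rule: bdf_order_cases) (simp_all add: bdf_alpha_def)
  then have c: "c > 0" using assms(4) by (simp add: c_def)
  define f where "f \<theta> = (1 - \<theta>) * (1 / \<Delta>t) * (\<Sum>j<k. bdf_b k j * \<phi> (n - j) \<theta>)
    - lam * C_op \<alpha> (\<phi> (n + 1)) + \<theta> * \<phi>0" for \<theta>
  have lower: "min c 1 \<le> c * (1 - \<theta>) + \<theta>" if "\<theta> \<in> {0<..<1}" for \<theta>
  proof -
    have "min c 1 * (1 - \<theta>) \<le> c * (1 - \<theta>)" "min c 1 * \<theta> \<le> 1 * \<theta>"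
      using that by (intro mult_right_mono; simp)+
    then show ?thesis by (simp add: algebra_simps)
  qed
  have "tame (\<lambda>\<theta>. f \<theta> / (c * (1 - \<theta>) + \<theta>))"
    unfolding f_def using c lower by (intro tame_divide[where c = "min c 1"] tame_intros tame) auto
  moreover have "\<phi> (n + 1) \<theta> = f \<theta> / (c * (1 - \<theta>) + \<theta>)" if "\<theta> \<in> {0<..<1}" for \<theta>
  proof -
    have "c * (1 - \<theta>) + \<theta> > 0" using lower[OF that] c by (smt (verit))
    moreover have "\<phi> (n + 1) \<theta> * (c * (1 - \<theta>) + \<theta>) = f \<theta>"
      using step that unfolding bdf_step_def f_def c_def bdf_op_def
      by (auto simp: algebra_simps diff_divide_distrib dest!: bspec[of _ _ \<theta>])
    ultimately show ?thesis by (simp add: field_simps)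
  qed
  ultimately show ?thesis by (rule tame_cong)
qed

section \<open>Stability\<close>

lemma sum_shift_diff:
  fixes y :: "nat \<Rightarrow> real"
  shows "(\<Sum>i<d. y (m + i + 1) - c * y (m + i))
    = (1 - c) * (\<Sum>i<d. y (m + i + 1)) + c * (y (m + d) - y m)"
  by (induction d) (simp_all add: algebra_simps)

text \<open>The two sides differ by half the square of \<open>c - (a - t * b)\<close>. With the
  initial value for \<open>c\<close>, source and multiplier are handled in one estimate.\<close>

lemma young_multiplier: "(a\<^sup>2 - t\<^sup>2 * b\<^sup>2 - c\<^sup>2) / 2 \<le> (a - c) * (a - t * b)"
  for a b c t :: real
proof -
  have "0 \<le> (c - (a - t * b))\<^sup>2" by simp
  then show ?thesis by (simp add: power2_eq_square field_simps)
qed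

text \<open>The memory values \<open>F\<close> are carried along as given numbers on the left: their
  products with the test functions acquire a sign only after integration over \<theta>.\<close>

lemma (in bdf_multiplier) pointwise_stability:
  fixes x F p q :: "nat \<Rightarrow> real" and \<theta> h lam c0 c1 :: real and d :: nat
  assumes \<theta>: "0 < \<theta>" "\<theta> < 1" and h: "h > 0"
    and energy: "energy k G (k - 1) x
      \<le> c0 * (x 0)\<^sup>2 + (\<Sum>i<k-1. bdf_op (i + 1) x i * (p i * x (i + 1) + q i * x i))"
    and dissipation: "\<tau>\<^sup>2 / 2 * (x (k - 1))\<^sup>2
      \<le> c1 * (x 0)\<^sup>2 + (\<Sum>i<k-1. (x (i + 1) - x 0) * (p i * x (i + 1) + q i * x i))"
    and start: "\<And>i. i < k - 1 \<Longrightarrow>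
      (1 - \<theta>) * bdf_op (i + 1) x i = - (h * \<theta> * (x (i + 1) - x 0)) - h * lam * F (i + 1)"
    and main: "\<And>i. i < d \<Longrightarrow> (1 - \<theta>) * bdf_op k x (k - 1 + i)
      = - (h * \<theta> * (x (k - 1 + i + 1) - x 0)) - h * lam * F (k - 1 + i + 1)"
  shows "lambda_min G * ((1 - \<theta>) * (x (k - 1 + d))\<^sup>2)
      + h / 2 * (1 - \<tau>\<^sup>2) * (\<Sum>i<d. \<theta> * (x (k - 1 + i + 1))\<^sup>2)
      + h * lam * ((\<Sum>i<d. F (k - 1 + i + 1) * (x (k - 1 + i + 1) - \<tau> * x (k - 1 + i)))
        + (\<Sum>i<k-1. F (i + 1) * (p i * x (i + 1) + q i * x i)))
    \<le> c0 * (x 0)\<^sup>2 * (1 - \<theta>) + h * (c1 + d / 2) * (x 0)\<^sup>2 * \<theta>"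
proof -
  define m where "m = k - 1"
  define v where "v i = p i * x (i + 1) + q i * x i" for i
  define w where "w i = x (m + i + 1) - \<tau> * x (m + i)" for i
  define A where "A = (\<Sum>i<d. F (m + i + 1) * w i)"
  define B where "B = (\<Sum>i<k-1. F (i + 1) * v i)"
  define S where "S = (\<Sum>i<d. (x (m + i + 1))\<^sup>2)"
  define D where "D = (\<Sum>i<d. (x (m + i + 1) - x 0) * w i)"
  define D0 where "D0 = (\<Sum>i<k-1. (x (i + 1) - x 0) * v i)"
  have G: "G \<in> carrier_mat k k" "transpose_mat G = G"
    using pos unfolding pos_def_symmetric_def by blast+
  have lower: "lambda_min G * (x (m + d))\<^sup>2 \<le> energy k G (m + d) x"
  proof -
    \<comment> \<open>The newest value is entry \<open>k - 1\<close> of the window; the other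
      squares are dropped.\<close>
    have "(x (m + d))\<^sup>2 \<le> (\<Sum>i<k. (x (m + d + 1 + i - k))\<^sup>2)"
      using order member_le_sum[of "k - 1" "{..<k}" "\<lambda>i. (x (m + d + 1 + i - k))\<^sup>2"] by simp
    then have "lambda_min G * (x (m + d))\<^sup>2 \<le> lambda_min G * (\<Sum>i<k. (x (m + d + 1 + i - k))\<^sup>2)"
      using pos_def_lambda_min_nonneg[OF pos order(1)] by (rule mult_left_mono)
    also have "\<dots> \<le> energy k G (m + d) x"
      unfolding energy_def by (rule rayleigh_bounds(2)[OF G order(1)])
    finally show ?thesis .
  qed
  have main_sum: "(1 - \<theta>) * (\<Sum>i<d. bdf_op k x (m + i) * w i) = - (h * \<theta> * D) - h * lam * A"
  proof -
    have "(1 - \<theta>) * (\<Sum>i<d. bdf_op k x (m + i) * w i)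
        = (\<Sum>i<d. (1 - \<theta>) * bdf_op k x (m + i) * w i)"
      by (simp add: sum_distrib_left mult.assoc)
    also have "\<dots> = (\<Sum>i<d. - (h * \<theta> * ((x (m + i + 1) - x 0) * w i)) - h * lam * (F (m + i + 1) * w i))"
    proof (intro sum.cong refl)
      fix i assume "i \<in> {..<d}"
      then have step: "(1 - \<theta>) * bdf_op k x (m + i)
          = - (h * \<theta> * (x (m + i + 1) - x 0)) - h * lam * F (m + i + 1)"
        unfolding m_def by (intro main) simp
      show "(1 - \<theta>) * bdf_op k x (m + i) * w i
          = - (h * \<theta> * ((x (m + i + 1) - x 0) * w i)) - h * lam * (F (m + i + 1) * w i)"
        unfolding step by (simp add: algebra_simps)
    qed
    finally show ?thesis
      by (simp add: sum_subtractf sum_negf A_def D_def sum_distrib_left)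
  qed
  have start_sum: "(1 - \<theta>) * (\<Sum>i<k-1. bdf_op (i + 1) x i * v i) = - (h * \<theta> * D0) - h * lam * B"
  proof -
    have "(1 - \<theta>) * (\<Sum>i<k-1. bdf_op (i + 1) x i * v i)
        = (\<Sum>i<k-1. (1 - \<theta>) * bdf_op (i + 1) x i * v i)"
      by (simp add: sum_distrib_left mult.assoc)
    also have "\<dots> = (\<Sum>i<k-1. - (h * \<theta> * ((x (i + 1) - x 0) * v i)) - h * lam * (F (i + 1) * v i))"
    proof (intro sum.cong refl)
      fix i assume "i \<in> {..<k-1}"
      then have step: "(1 - \<theta>) * bdf_op (i + 1) x i
          = - (h * \<theta> * (x (i + 1) - x 0)) - h * lam * F (i + 1)"
        by (intro start) simp
      show "(1 - \<theta>) * bdf_op (i + 1) x i * v i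
          = - (h * \<theta> * ((x (i + 1) - x 0) * v i)) - h * lam * (F (i + 1) * v i)"
        unfolding step by (simp add: algebra_simps)
    qed
    finally show ?thesis
      by (simp add: sum_subtractf sum_negf B_def D0_def sum_distrib_left)
  qed
  have "energy k G (m + d) x \<le> c0 * (x 0)\<^sup>2 + (\<Sum>i<k-1. bdf_op (i + 1) x i * v i)
      + (\<Sum>i<d. bdf_op k x (m + i) * w i)"
    using energy_le_telescoped[of m d x] energy order by (simp add: m_def v_def w_def)
  with lower have "lambda_min G * (x (m + d))\<^sup>2 \<le> c0 * (x 0)\<^sup>2
      + (\<Sum>i<k-1. bdf_op (i + 1) x i * v i) + (\<Sum>i<d. bdf_op k x (m + i) * w i)"
    by linarith
  then have "(1 - \<theta>) * (lambda_min G * (x (m + d))\<^sup>2) \<le> (1 - \<theta>) * (c0 * (x 0)\<^sup>2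
      + (\<Sum>i<k-1. bdf_op (i + 1) x i * v i) + (\<Sum>i<d. bdf_op k x (m + i) * w i))"
    using \<theta> by (intro mult_left_mono) auto
  also have "\<dots> = (1 - \<theta>) * (c0 * (x 0)\<^sup>2) - h * \<theta> * (D0 + D) - h * lam * (A + B)"
    unfolding distrib_left main_sum start_sum by (simp add: algebra_simps)
  finally have bound: "(1 - \<theta>) * (lambda_min G * (x (m + d))\<^sup>2)
      \<le> (1 - \<theta>) * (c0 * (x 0)\<^sup>2) - h * \<theta> * (D0 + D) - h * lam * (A + B)" .
  \<comment> \<open>Young's inequality is summed over the main steps. The telescoped term at the
    newest value is nonnegative and dropped; the one at \<open>x m\<close> is covered by
    \<open>dissipation\<close>.\<close>
  have "((1 - \<tau>\<^sup>2) * S - \<tau>\<^sup>2 * (x m)\<^sup>2 - d * (x 0)\<^sup>2) / 2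
      \<le> ((1 - \<tau>\<^sup>2) * S + \<tau>\<^sup>2 * ((x (m + d))\<^sup>2 - (x m)\<^sup>2) - d * (x 0)\<^sup>2) / 2"
    by (simp add: right_diff_distrib)
  also have "\<dots> = (\<Sum>i<d. ((x (m + i + 1))\<^sup>2 - \<tau>\<^sup>2 * (x (m + i))\<^sup>2 - (x 0)\<^sup>2) / 2)"
    using sum_shift_diff[of "\<lambda>n. (x n)\<^sup>2" m "\<tau>\<^sup>2" d]
    by (simp add: S_def sum_subtractf flip: sum_divide_distrib)
  also have "\<dots> \<le> D"
    unfolding D_def w_def by (intro sum_mono young_multiplier)
  finally have "((1 - \<tau>\<^sup>2) * S - \<tau>\<^sup>2 * (x m)\<^sup>2 - d * (x 0)\<^sup>2) / 2 \<le> D" .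
  moreover have "\<tau>\<^sup>2 / 2 * (x m)\<^sup>2 \<le> c1 * (x 0)\<^sup>2 + D0"
    using dissipation by (simp add: m_def D0_def v_def)
  ultimately have "(1 - \<tau>\<^sup>2) / 2 * S - (c1 + d / 2) * (x 0)\<^sup>2 \<le> D0 + D"
    by (simp add: algebra_simps add_divide_distrib diff_divide_distrib)
  then have "h * \<theta> * ((1 - \<tau>\<^sup>2) / 2 * S - (c1 + d / 2) * (x 0)\<^sup>2) \<le> h * \<theta> * (D0 + D)"
    using h \<theta> by (intro mult_left_mono) auto
  with bound have "(1 - \<theta>) * (lambda_min G * (x (m + d))\<^sup>2)
      + h * \<theta> * ((1 - \<tau>\<^sup>2) / 2 * S - (c1 + d / 2) * (x 0)\<^sup>2) + h * lam * (A + B)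
      \<le> (1 - \<theta>) * (c0 * (x 0)\<^sup>2)"
    by linarith
  then have "lambda_min G * ((1 - \<theta>) * (x (m + d))\<^sup>2) + h / 2 * (1 - \<tau>\<^sup>2) * (\<theta> * S)
      + h * lam * (A + B) \<le> c0 * (x 0)\<^sup>2 * (1 - \<theta>) + h * (c1 + d / 2) * (x 0)\<^sup>2 * \<theta>"
    by (simp add: algebra_simps add_divide_distrib diff_divide_distrib)
  then show ?thesis
    unfolding A_def B_def S_def w_def v_def m_def sum_distrib_left[of \<theta>] .
qed

lemma young_square: "(a\<^sup>2 - t\<^sup>2 * b\<^sup>2) / 2 \<le> a * (a - t * b)"
  for a b t :: real
  using young_multiplier[of a t b 0] by simp

theorem theorem2:
  fixes \<alpha> T \<phi>0 lam \<Delta>t \<tau> :: real and k N :: nat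
    and G :: "real mat" and \<phi> :: "nat \<Rightarrow> real \<Rightarrow> real"
  assumes "0 < \<alpha>" and "\<alpha> < 1" and "T > 0" and "lam \<ge> 0"
    and "1 \<le> k" and "k \<le> 5" and "k \<le> N + 1"
    and "\<Delta>t = T / (real N + 1)"
    and "is_bdf_tau k \<tau>"
    and "pos_def_symmetric k G"
    and "\<exists>\<delta>. multiplier_identity TYPE(real) k \<tau> G \<delta>"
    and initial: "\<forall>\<theta>\<in>{0<..<1}. \<phi> 0 \<theta> = \<phi>0"
    and starting: "\<forall>j\<in>{1..<k}. bdf_step \<alpha> lam \<Delta>t \<phi>0 j \<phi> (j - 1)"
    and scheme: "\<forall>n\<in>{k - 1..N}. bdf_step \<alpha> lam \<Delta>t \<phi>0 k \<phi> n"
  shows "lambda_min G * weighted_norm_sq (omega0 \<alpha>) (\<phi> (N + 1))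
      + \<Delta>t / 2 * (1 - \<tau>\<^sup>2) *
        (\<Sum>n=k - 1..N. (weighted_norm_sq (omega1 \<alpha>) (\<phi> (n + 1))
          + lam * \<bar>C_op \<alpha> (\<phi> (n + 1))\<bar>\<^sup>2))
    \<le> 1 / (1 - \<tau>\<^sup>2) * (lambda_max G * \<alpha> + T / 2 * (1 - \<alpha>)) * \<bar>\<phi>0\<bar>\<^sup>2"
proof -
  interpret weight \<alpha> using assms(1,2) by unfold_locales
  obtain \<delta> where "multiplier_identity TYPE(real) k \<tau> G \<delta>" using assms(11) by blast
  then interpret bdf_multiplier k \<tau> G \<delta> using assms(5,6,10) by unfold_locales
  obtain p q c0 c1 where \<tau>: "\<tau>\<^sup>2 < 1" "k = 1 \<Longrightarrow> \<tau> = 0" and q: "q 0 = 0"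
    and c0: "c0 * (1 - \<tau>\<^sup>2) \<le> lambda_max G" and c1: "2 * c1 + 1 \<le> k / (1 - \<tau>\<^sup>2)"
    and energy: "\<And>x. energy k G (k - 1) x
      \<le> c0 * (x 0)\<^sup>2 + (\<Sum>i<k-1. bdf_op (i + 1) x i * (p i * x (i + 1) + q i * x i))"
    and dissipation: "\<And>x. \<tau>\<^sup>2 / 2 * (x (k - 1))\<^sup>2
      \<le> c1 * (x 0)\<^sup>2 + (\<Sum>i<k-1. (x (i + 1) - x 0) * (p i * x (i + 1) + q i * x i))"
    by (rule starting_multipliers[OF assms(9)]) (rule that; assumption)
  have h: "\<Delta>t > 0" using assms(3,8) by simp
  define m where "m = k - 1"
  \<comment> \<open>The number of main steps, which produce the levels \<open>m + 1\<close> to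
    \<open>m + d\<close>; \<open>m\<close> is the last starting level.\<close>
  define d where "d = N + 2 - k"
  have md: "m + d = N + 1" using assms(5,7) by (simp add: m_def d_def)
  have shift: "(\<Sum>n=k - 1..N. f n) = (\<Sum>i<d. f (m + i))" for f :: "nat \<Rightarrow> real"
    by (rule sum.reindex_bij_witness[of _ "\<lambda>i. m + i" "\<lambda>n. n - m"])
      (use md in \<open>auto simp: m_def\<close>)
  have tame: "tame (\<phi> n)" if "n \<le> N + 1" for n
    using that
  proof (induction n rule: less_induct)
    case (less n)
    show ?case
    proof (cases "n = 0")
      case True
      then show ?thesis using initial by (intro tame_cong[OF tame_const[of \<phi>0]]) auto
    next
      case False
      \<comment> \<open>Level \<open>n\<close> comes from the scheme of order \<open>n\<close> in
        the starting phase and of order \<open>k\<close> afterwards.\<close>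
      define r where "r = min n k"
      have "bdf_step \<alpha> lam \<Delta>t \<phi>0 r \<phi> (n - 1)"
      proof (cases "n < k")
        case True
        then show ?thesis using False starting by (simp add: r_def)
      next
        case False
        then have "n - 1 \<in> {k - 1..N}" using less.prems by auto
        then show ?thesis using False scheme by (simp add: r_def)
      qed
      then have "tame (\<phi> (n - 1 + 1))"
      proof (rule bdf_step_tame[OF _ _ _ h])
        show "1 \<le> r" "r \<le> 5" using False order by (simp_all add: r_def)
        show "tame (\<phi> (n - 1 - j))" if "j < r" for j
          using False less.prems by (intro less.IH) auto
      qed
      then show ?thesis using False by simp
    qed
  qed
  define F where "F n = C_op \<alpha> (\<phi> n)" for n
  define w where "w i \<theta> = \<phi> (m + i + 1) \<theta> - \<tau> * \<phi> (m + i) \<theta>" for i \<theta>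
  define v where "v i \<theta> = p i * \<phi> (i + 1) \<theta> + q i * \<phi> i \<theta>" for i \<theta>
  define lhs where "lhs \<theta> = lambda_min G * ((1 - \<theta>) * (\<phi> (m + d) \<theta>)\<^sup>2)
      + \<Delta>t / 2 * (1 - \<tau>\<^sup>2) * (\<Sum>i<d. \<theta> * (\<phi> (m + i + 1) \<theta>)\<^sup>2)
      + \<Delta>t * lam * ((\<Sum>i<d. F (m + i + 1) * w i \<theta>) + (\<Sum>i<m. F (i + 1) * v i \<theta>))" for \<theta>
  define rhs where "rhs \<theta> = c0 * \<phi>0\<^sup>2 * (1 - \<theta>) + \<Delta>t * (c1 + d / 2) * \<phi>0\<^sup>2 * \<theta>" for \<theta>
  have step: "(1 - \<theta>) * bdf_op r (\<lambda>n. \<phi> n \<theta>) n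
      = - (\<Delta>t * \<theta> * (\<phi> (n + 1) \<theta> - \<phi> 0 \<theta>)) - \<Delta>t * lam * F (n + 1)"
    if "bdf_step \<alpha> lam \<Delta>t \<phi>0 r \<phi> n" "\<theta> \<in> {0<..<1}" for r n \<theta>
  proof -
    have "(1 - \<theta>) / \<Delta>t * bdf_op r (\<lambda>n. \<phi> n \<theta>) n = \<theta> * \<phi> 0 \<theta> - \<theta> * \<phi> (n + 1) \<theta> - lam * F (n + 1)"
      using that initial unfolding bdf_step_def F_def by (auto simp: algebra_simps)
    then have "\<Delta>t * ((1 - \<theta>) / \<Delta>t * bdf_op r (\<lambda>n. \<phi> n \<theta>) n)
        = \<Delta>t * (\<theta> * \<phi> 0 \<theta> - \<theta> * \<phi> (n + 1) \<theta> - lam * F (n + 1))" by simp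
    moreover have "\<Delta>t * ((1 - \<theta>) / \<Delta>t * bdf_op r (\<lambda>n. \<phi> n \<theta>) n) = (1 - \<theta>) * bdf_op r (\<lambda>n. \<phi> n \<theta>) n"
      using h by simp
    ultimately show ?thesis by (simp add: algebra_simps)
  qed
  have pointwise: "lhs \<theta> \<le> rhs \<theta>" if \<theta>: "\<theta> \<in> {0<..<1}" for \<theta>
  proof -
    have "lhs \<theta> \<le> c0 * (\<phi> 0 \<theta>)\<^sup>2 * (1 - \<theta>) + \<Delta>t * (c1 + d / 2) * (\<phi> 0 \<theta>)\<^sup>2 * \<theta>"
      unfolding lhs_def w_def v_def m_def
    proof (rule pointwise_stability[OF _ _ h energy dissipation])
      fix i assume "i < k - 1"
      then show "(1 - \<theta>) * bdf_op (i + 1) (\<lambda>n. \<phi> n \<theta>) i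
          = - (\<Delta>t * \<theta> * (\<phi> (i + 1) \<theta> - \<phi> 0 \<theta>)) - \<Delta>t * lam * F (i + 1)"
        using starting by (intro step[OF _ \<theta>]) (auto dest: bspec[of _ _ "i + 1"])
    next
      fix i assume "i < d"
      then show "(1 - \<theta>) * bdf_op k (\<lambda>n. \<phi> n \<theta>) (k - 1 + i)
          = - (\<Delta>t * \<theta> * (\<phi> (k - 1 + i + 1) \<theta> - \<phi> 0 \<theta>)) - \<Delta>t * lam * F (k - 1 + i + 1)"
        using scheme md by (intro step[OF _ \<theta>]) (auto simp: m_def)
    qed (use \<theta> in auto)
    then show ?thesis using initial \<theta> by (simp add: rhs_def)
  qed
  have tame_w: "tame (w i)" if "i < d" for i
    unfolding w_def using that md by (intro tame_intros tame) auto
  have tame_v: "tame (v i)" if "i < m" for i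
    unfolding v_def using that md by (intro tame_intros tame) auto
  have C_w: "C_op \<alpha> (w i) = F (m + i + 1) - \<tau> * F (m + i)" if "i < d" for i
    unfolding w_def F_def using that md
    by (subst C_op_diff) (auto intro!: tame_intros tame simp: C_op_cmult)
  have C_v: "C_op \<alpha> (v i) = p i * F (i + 1) + q i * F i" if "i < m" for i
    unfolding v_def F_def using that md
    by (subst C_op_add) (auto intro!: tame_intros tame simp: C_op_cmult)
  define N0 where "N0 = weighted_norm_sq (omega0 \<alpha>) (\<phi> (N + 1))"
  define N1 where "N1 n = weighted_norm_sq (omega1 \<alpha>) (\<phi> n)" for n
  \<comment> \<open>Integration turns the test functions \<open>w i\<close> and \<open>v i\<close>
    into the same combinations of memory values, so the coupling becomes a quadratic form in
    \<open>F\<close>.\<close>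
  define R where "R = (\<Sum>i<d. F (m + i + 1) * (F (m + i + 1) - \<tau> * F (m + i)))
    + (\<Sum>i<m. F (i + 1) * (p i * F (i + 1) + q i * F i))"
  have C_lhs: "C_op \<alpha> lhs = lambda_min G * N0 + \<Delta>t / 2 * (1 - \<tau>\<^sup>2) * (\<Sum>i<d. N1 (m + i + 1))
      + \<Delta>t * lam * R"
  proof -
    have 1: "tame (\<lambda>\<theta>. (1 - \<theta>) * (\<phi> (m + d) \<theta>)\<^sup>2)"
      using md by (intro tame_intros tame) auto
    have 2: "tame (\<lambda>\<theta>. \<theta> * (\<phi> (m + i + 1) \<theta>)\<^sup>2)" if "i < d" for i
      using md that by (intro tame_intros tame) auto
    have 3: "tame (\<lambda>\<theta>. \<Sum>i<d. \<theta> * (\<phi> (m + i + 1) \<theta>)\<^sup>2)"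
      using 2 by (intro tame_sum) auto
    have 4: "tame (\<lambda>\<theta>. \<Sum>i<d. F (m + i + 1) * w i \<theta>)" "tame (\<lambda>\<theta>. \<Sum>i<m. F (i + 1) * v i \<theta>)"
      using tame_w tame_v by (auto intro!: tame_intros)
    have "C_op \<alpha> lhs = lambda_min G * C_op \<alpha> (\<lambda>\<theta>. (1 - \<theta>) * (\<phi> (m + d) \<theta>)\<^sup>2)
      + \<Delta>t / 2 * (1 - \<tau>\<^sup>2) * C_op \<alpha> (\<lambda>\<theta>. \<Sum>i<d. \<theta> * (\<phi> (m + i + 1) \<theta>)\<^sup>2)
      + \<Delta>t * lam * (C_op \<alpha> (\<lambda>\<theta>. \<Sum>i<d. F (m + i + 1) * w i \<theta>)
        + C_op \<alpha> (\<lambda>\<theta>. \<Sum>i<m. F (i + 1) * v i \<theta>))"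
      unfolding lhs_def[abs_def]
      by (simp only: C_op_add C_op_cmult tame_add tame_mult tame_const 1 3 4)
    also have "C_op \<alpha> (\<lambda>\<theta>. (1 - \<theta>) * (\<phi> (m + d) \<theta>)\<^sup>2) = N0"
      unfolding N0_def weighted_norm_sq_omega0 md ..
    also have "C_op \<alpha> (\<lambda>\<theta>. \<Sum>i<d. \<theta> * (\<phi> (m + i + 1) \<theta>)\<^sup>2) = (\<Sum>i<d. N1 (m + i + 1))"
      unfolding N1_def weighted_norm_sq_omega1 using 2 by (intro C_op_sum) auto
    also have "C_op \<alpha> (\<lambda>\<theta>. \<Sum>i<d. F (m + i + 1) * w i \<theta>)
        = (\<Sum>i<d. F (m + i + 1) * (F (m + i + 1) - \<tau> * F (m + i)))"
      using tame_w by (subst C_op_sum) (auto intro!: tame_intros simp: C_op_cmult C_w)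
    also have "C_op \<alpha> (\<lambda>\<theta>. \<Sum>i<m. F (i + 1) * v i \<theta>)
        = (\<Sum>i<m. F (i + 1) * (p i * F (i + 1) + q i * F i))"
      using tame_v by (subst C_op_sum) (auto intro!: tame_intros simp: C_op_cmult C_v)
    finally show ?thesis unfolding R_def .
  qed
  have C_rhs: "C_op \<alpha> rhs = (c0 * \<alpha> + \<Delta>t * (c1 + d / 2) * (1 - \<alpha>)) * \<phi>0\<^sup>2"
  proof -
    have "C_op \<alpha> (\<lambda>\<theta>. 1 - \<theta>) = \<alpha>"
      using C_op_diff[OF tame_const[of 1] tame_ident] by (simp add: C_op_1 C_op_ident)
    then have "C_op \<alpha> rhs = c0 * \<phi>0\<^sup>2 * \<alpha> + \<Delta>t * (c1 + d / 2) * \<phi>0\<^sup>2 * (1 - \<alpha>)"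
      unfolding rhs_def[abs_def]
      by (simp only: C_op_add C_op_cmult C_op_ident tame_mult tame_diff tame_const tame_ident)
    then show ?thesis by (simp add: algebra_simps)
  qed
  have R: "(1 - \<tau>\<^sup>2) / 2 * (\<Sum>i<d. (F (m + i + 1))\<^sup>2) \<le> R"
  proof -
    \<comment> \<open>\<open>dissipation\<close> holds for every real sequence. Setting the initial
      memory value to 0 turns increments over it into plain values, and \<open>q 0 = 0\<close> makes
      the change invisible in the sum. For \<open>k = 1\<close> the changed value would be
      \<open>F m\<close> itself, but then \<tau> vanishes.\<close>
    let ?F = "F(0 := 0)"
    have "\<tau>\<^sup>2 / 2 * (F m)\<^sup>2 \<le> (\<Sum>i<m. F (i + 1) * (p i * F (i + 1) + q i * F i))"
    proof (cases "k = 1")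
      case True
      then show ?thesis using \<tau> by (simp add: m_def)
    next
      case False
      then have "m \<noteq> 0" using order by (simp add: m_def)
      then have "\<tau>\<^sup>2 / 2 * (F m)\<^sup>2 \<le> (\<Sum>i<m. F (i + 1) * (p i * F (i + 1) + q i * ?F i))"
        using dissipation[of ?F] by (simp add: m_def)
      also have "\<dots> = (\<Sum>i<m. F (i + 1) * (p i * F (i + 1) + q i * F i))"
        using q by (intro sum.cong) auto
      finally show ?thesis .
    qed
    moreover have "((1 - \<tau>\<^sup>2) * (\<Sum>i<d. (F (m + i + 1))\<^sup>2) - \<tau>\<^sup>2 * (F m)\<^sup>2) / 2
        \<le> (\<Sum>i<d. F (m + i + 1) * (F (m + i + 1) - \<tau> * F (m + i)))"
    proof -
      have "((1 - \<tau>\<^sup>2) * (\<Sum>i<d. (F (m + i + 1))\<^sup>2) - \<tau>\<^sup>2 * (F m)\<^sup>2) / 2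
          \<le> ((1 - \<tau>\<^sup>2) * (\<Sum>i<d. (F (m + i + 1))\<^sup>2) + \<tau>\<^sup>2 * ((F (m + d))\<^sup>2 - (F m)\<^sup>2)) / 2"
        by (simp add: right_diff_distrib)
      also have "\<dots> = (\<Sum>i<d. ((F (m + i + 1))\<^sup>2 - \<tau>\<^sup>2 * (F (m + i))\<^sup>2) / 2)"
        using sum_shift_diff[of "\<lambda>n. (F n)\<^sup>2" m "\<tau>\<^sup>2" d] by (simp flip: sum_divide_distrib)
      also have "\<dots> \<le> (\<Sum>i<d. F (m + i + 1) * (F (m + i + 1) - \<tau> * F (m + i)))"
        by (intro sum_mono young_square)
      finally show ?thesis .
    qed
    ultimately show ?thesis
      unfolding R_def by (simp add: algebra_simps add_divide_distrib diff_divide_distrib)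
  qed
  have "C_op \<alpha> lhs \<le> C_op \<alpha> rhs"
  proof (rule C_op_mono)
    show "tame lhs" unfolding lhs_def[abs_def]
      using md tame_w tame_v by (intro tame_intros tame) auto
    show "tame rhs" unfolding rhs_def[abs_def] by (intro tame_intros)
  qed (rule pointwise)
  moreover have "\<Delta>t * lam * ((1 - \<tau>\<^sup>2) / 2 * (\<Sum>i<d. (F (m + i + 1))\<^sup>2)) \<le> \<Delta>t * lam * R"
    using R h assms(4) by (intro mult_left_mono) auto
  ultimately have "lambda_min G * N0 + \<Delta>t / 2 * (1 - \<tau>\<^sup>2) * (\<Sum>i<d. N1 (m + i + 1))
      + \<Delta>t * lam * ((1 - \<tau>\<^sup>2) / 2 * (\<Sum>i<d. (F (m + i + 1))\<^sup>2))
      \<le> (c0 * \<alpha> + \<Delta>t * (c1 + d / 2) * (1 - \<alpha>)) * \<phi>0\<^sup>2"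
    unfolding C_lhs C_rhs by linarith
  moreover have "\<Delta>t / 2 * (1 - \<tau>\<^sup>2) * (\<Sum>i<d. N1 (m + i + 1) + lam * \<bar>F (m + i + 1)\<bar>\<^sup>2)
      = \<Delta>t / 2 * (1 - \<tau>\<^sup>2) * (\<Sum>i<d. N1 (m + i + 1))
      + \<Delta>t * lam * ((1 - \<tau>\<^sup>2) / 2 * (\<Sum>i<d. (F (m + i + 1))\<^sup>2))"
    by (simp add: sum.distrib flip: sum_distrib_left) (simp add: algebra_simps)
  ultimately have "lambda_min G * N0
      + \<Delta>t / 2 * (1 - \<tau>\<^sup>2) * (\<Sum>i<d. N1 (m + i + 1) + lam * \<bar>F (m + i + 1)\<bar>\<^sup>2)
      \<le> (c0 * \<alpha> + \<Delta>t * (c1 + d / 2) * (1 - \<alpha>)) * \<phi>0\<^sup>2"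
    by linarith
  also have "\<dots> \<le> 1 / (1 - \<tau>\<^sup>2) * (lambda_max G * \<alpha> + T / 2 * (1 - \<alpha>)) * \<phi>0\<^sup>2"
  proof (rule mult_right_mono)
    define s where "s = 1 / (1 - \<tau>\<^sup>2)"
    have s: "s \<ge> 1" using \<tau> by (simp add: s_def)
    have "c0 * \<alpha> \<le> s * lambda_max G * \<alpha>"
      using c0 \<tau> \<alpha> by (intro mult_right_mono) (simp_all add: s_def field_simps)
    moreover have "\<Delta>t * (c1 + d / 2) \<le> s * (T / 2)"
    proof -
      \<comment> \<open>The \<open>N + 1\<close> time steps are counted as \<open>k\<close> steps
        for the start together with the first main step, and \<open>d - 1\<close> further ones. The
        former absorb \<open>2 * c1 + 1\<close>, the latter only need
        \<open>s \<ge> 1\<close>.\<close>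
      have T: "T = \<Delta>t * (k + (real d - 1))"
        using assms(5,7,8) by (simp add: d_def field_simps)
      have "c1 + d / 2 \<le> (s * k + (real d - 1)) / 2"
        using c1 by (simp add: s_def)
      also have "\<dots> \<le> (s * k + s * (real d - 1)) / 2"
        using s mult_right_mono[OF s, of "real d - 1"] assms(5,7) by (simp add: d_def)
      finally have "\<Delta>t * (c1 + d / 2) \<le> \<Delta>t * ((s * k + s * (real d - 1)) / 2)"
        using h by (intro mult_left_mono) auto
      then show ?thesis unfolding T by (simp add: algebra_simps)
    qed
    then have "\<Delta>t * (c1 + d / 2) * (1 - \<alpha>) \<le> s * (T / 2) * (1 - \<alpha>)"
      using \<alpha> by (intro mult_right_mono) auto
    ultimately show "c0 * \<alpha> + \<Delta>t * (c1 + d / 2) * (1 - \<alpha>)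
        \<le> 1 / (1 - \<tau>\<^sup>2) * (lambda_max G * \<alpha> + T / 2 * (1 - \<alpha>))"
      unfolding s_def[symmetric] distrib_left mult.assoc by linarith
  qed simp
  finally show ?thesis
    unfolding shift N0_def N1_def F_def by simp
qed

end
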